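(* Let $G\in M_n(\mathbb{R})$ have a positive definite symmetric part $\frac12(G+G^T)$, let $Q:=-G^{-1}$, and suppose there exists a $1$-permanental vector $\ell$ with kernel $G$. Then for any real function $f$ on $\mathbb{R}_+^n$ with a subexponential growth rate, $$\mathbb{E}[f(\ell)]=\int_{\mathbb{C}^n}\frac{1}{(2\pi\mathrm{i})^n|G|}\,f(\phi\bar\phi)\,e^{\langle\phi,Q\bar\phi\rangle}\,d\bar\phi\,d\phi ,$$ where $\phi\bar\phi:=(\phi_i\bar\phi_i)_{i\in[n]}$. Moreover, for any integer $k\ge1$, the $k$-permanental vector $\ell^{(k)}$ with kernel $G$ satisfies $$\mathbb{E}\big[f(\ell^{(k)})\big]=\int_{\mathbb{C}^{n\times k}}\frac{1}{(2\pi\mathrm{i})^{nk}|G|^k}\,f\big(\phi^{(1)}\overline{\phi^{(1)}}+\cdots+\phi^{(k)}\overline{\phi^{(k)}}\big)\,e^{\sum_{i=1}^k\langle\phi^{(i)},Q\overline{\phi^{(i)}}\rangle}\prod_{i=1}^k d\overline{\phi^{(i)}}\,d\phi^{(i)} .$$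
   Context: $M_n(\mathbb{R})$ is the set of real $n\times n$ matrices; $|A|$ is the determinant of $A$; $[n]=\{1,\dots,n\}$; $\mathbb{R}_+=[0,\infty)$. For $\alpha>0$, a random vector $\ell\in\mathbb{R}_+^n$ is an $\alpha$-permanental vector with kernel $G$ if for every $\lambda\in\mathbb{R}_+^n$, $\mathbb{E}[e^{-\langle\lambda,\ell\rangle}]=|I+\Lambda G|^{-\alpha}$, where $\Lambda=\mathrm{diag}(\lambda_1,\dots,\lambda_n)$. A function $f$ on $\mathbb{R}_+^n$ has subexponential growth rate if $\lim_{\|l\|\to\infty}\frac{\log(1+|f(l)|)}{\|l\|}=0$. For $\phi,\psi\in\mathbb{C}^n$, $\langle\phi,\psi\rangle:=\sum_i\phi_i\psi_i$ (no conjugation). Writing $\phi=u+\mathrm{i}v$ with $u,v\in\mathbb{R}^n$, $(2\pi\mathrm{i})^{-n}\,d\bar\phi\,d\phi$ means $\pi^{-n}\,du\,dv$ (Lebesgue measure on $\mathbb{R}^{2n}$).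
   Formalization: The function f is assumed Borel measurable and either bounded on bounded sets or such that the right-hand integrand is absolutely integrable; subexponential growth alone does not make the two sides well defined (e.g. n=1, G=1, f(x)=1/(x-1)). *)

theory Defs
  imports "HOL-Probability.Probability"
begin

text \<open>$\mathbb{R}_+^n$ is the set of vectors with nonnegative coordinates.\<close>

definition nonneg_orthant :: "(real ^ 'n) set" where
  "nonneg_orthant = {x. \<forall>i. 0 \<le> x $ i}"

definition diag :: "real ^ 'n \<Rightarrow> real ^ 'n ^ 'n" where
  "diag v = (\<chi> i j. if i = j then v $ i else 0)"

definition positive_definite :: "real ^ 'n ^ 'n \<Rightarrow> bool" where
  "positive_definite A \<longleftrightarrow> transpose A = A \<and> (\<forall>x. x \<noteq> 0 \<longrightarrow> 0 < x \<bullet> (A *v x))"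

definition symmetric_part :: "real ^ 'n ^ 'n \<Rightarrow> real ^ 'n ^ 'n" where
  "symmetric_part A = (1 / 2) *\<^sub>R (A + transpose A)"

text \<open>The use of \<open>powr\<close> is harmless: the left-hand side of the identity lies in \<open>{0<..1}\<close>, the
  determinant is a polynomial in \<open>v\<close> with value 1 at \<open>v = 0\<close>, and \<open>0 powr _ = 0\<close>; hence the
  identity forces the determinant to be positive on the whole orthant.\<close>

definition permanental_vector ::
    "'a measure \<Rightarrow> real \<Rightarrow> real ^ 'n ^ 'n \<Rightarrow> ('a \<Rightarrow> real ^ 'n) \<Rightarrow> bool" where
  "permanental_vector M \<alpha> G l \<longleftrightarrow>
     prob_space M \<and> 0 < \<alpha> \<and>
     l \<in> borel_measurable M \<and> (\<forall>\<omega>\<in>space M. l \<omega> \<in> nonneg_orthant) \<and>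
     (\<forall>v\<in>nonneg_orthant.
        (\<integral>\<omega>. exp (- (v \<bullet> l \<omega>)) \<partial>M) = det (mat 1 + diag v ** G) powr (- \<alpha>))"

text \<open>The limit is taken as \<open>norm x \<longrightarrow> \<infinity>\<close> within the orthant; values of \<open>f\<close> outside the
  orthant are irrelevant.\<close>

definition subexponential_growth :: "(real ^ 'n \<Rightarrow> real) \<Rightarrow> bool" where
  "subexponential_growth f \<longleftrightarrow>
     ((\<lambda>x. ln (1 + \<bar>f x\<bar>) / norm x) \<longlongrightarrow> 0) (inf at_infinity (principal nonneg_orthant))"

text \<open>The pairing on $\mathbb{C}^n$ is bilinear, without conjugation.\<close>

definition cpair :: "complex ^ 'n \<Rightarrow> complex ^ 'n \<Rightarrow> complex" where
  "cpair \<phi> \<psi> = (\<Sum>i\<in>UNIV. \<phi> $ i * \<psi> $ i)"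

definition vcnj :: "complex ^ 'n \<Rightarrow> complex ^ 'n" where
  "vcnj \<phi> = (\<chi> i. cnj (\<phi> $ i))"

definition cmat :: "real ^ 'n ^ 'm \<Rightarrow> complex ^ 'n ^ 'm" where
  "cmat A = (\<chi> i j. complex_of_real (A $ i $ j))"

text \<open>The vector $\phi\bar\phi$, whose entries are real, as an element of the orthant.\<close>

definition mult_cnj :: "complex ^ 'n \<Rightarrow> real ^ 'n" where
  "mult_cnj \<phi> = (\<chi> i. Re (\<phi> $ i * cnj (\<phi> $ i)))"

text \<open>Boundedness on bounded subsets of the orthant. The growth condition above constrains
  \<open>f\<close> only near infinity.\<close>

definition locally_bounded :: "(real ^ 'n \<Rightarrow> real) \<Rightarrow> bool" where
  "locally_bounded f \<longleftrightarrow> (\<forall>B\<subseteq>nonneg_orthant. bounded B \<longrightarrow> bounded (f ` B))"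

text \<open>Integrals over $\mathbb{C}^n$ are taken against \<open>lborel\<close> on \<open>complex ^ 'n\<close>, which is
  Lebesgue measure $du\,dv$ for $\phi = u + \mathrm{i}v$, and over $\mathbb{C}^{n\times k}$ against
  its \<open>k\<close>-fold product. Thus $(2\pi\mathrm{i})^{-n}\,d\bar\phi\,d\phi$ is $\pi^{-n}$ times
  \<open>lborel\<close>.\<close>

end

theory Submission
  imports Defs
begin

text \<open>The complex density $\exp\langle\phi, Q\bar\phi\rangle / (\pi^n |G|)$ and the law of $\ell$ have the
  same Laplace transform on the orthant: multiplying the density by
  $e^{-\langle\lambda,\phi\bar\phi\rangle}$ replaces $-Q = G^{-1}$ by $G^{-1} + \Lambda$, whose symmetric part is
  still positive definite, and the complex Gaussian integral then gives
  $|G|^{-1} |G^{-1} + \Lambda|^{-1} = |I + \Lambda G|^{-1}$. For $k$ independent copies the integral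
  factorises. A Laplace transform determines the (complex) measure, so the law of $\ell$ is the image
  of the Gaussian density under $\phi \mapsto \phi\bar\phi$. Subexponential growth makes \<open>f\<close> integrable because
  $G^{-1} - \epsilon I$ still has a positive definite symmetric part for small $\epsilon$.\<close>

subsection \<open>Gaussian Fourier transforms\<close>

text \<open>\<open>G\<close> need not be symmetric, so the Gaussian density may have a nonconstant
  phase: it is in general the density of a complex measure and not of a probability. This shapes the
  proof in two places. A congruence can normalise only the symmetric part of the quadratic form; the
  antisymmetric part survives as a phase coupling the real and imaginary parts of \<phi>, and this
  phase is integrated as a Fourier transform. On the measure side, integrability under the law of
  \<open>l\<close> has to be extracted from integrability against the modulus of the density; this
  works because the law gives each Borel set a mass equal to the modulus of a complex integral,
  hence at most the integral of the modulus. The growth condition says nothing about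
  \<open>f\<close> on bounded sets, where a measurable function can be too large to integrate. This
  is the origin of the alternative between local boundedness of \<open>f\<close> and integrability
  of the Gaussian integrand.\<close>

lemma lborel_prod_Basis:
  fixes g :: "'a::euclidean_space \<Rightarrow> real \<Rightarrow> complex"
  assumes g: "\<And>b. b \<in> Basis \<Longrightarrow> integrable lborel (g b)"
  shows integrable_lborel_prod_Basis: "integrable lborel (\<lambda>x. \<Prod>b\<in>Basis. g b (x \<bullet> b))"
    and integral_lborel_prod_Basis:
      "(\<integral>x. (\<Prod>b\<in>Basis. g b (x \<bullet> b)) \<partial>lborel) = (\<Prod>b\<in>Basis. \<integral>t. g b t \<partial>lborel)"
proof -
  interpret product_sigma_finite "\<lambda>_::'a. lborel :: real measure" ..
  have [measurable]: "g b \<in> borel_measurable borel" if "b \<in> Basis" for b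
    using borel_measurable_integrable[OF g[OF that]] by simp
  have eq: "(\<Prod>b\<in>Basis. g b ((\<Sum>a\<in>Basis. f a *\<^sub>R a) \<bullet> b)) = (\<Prod>b\<in>Basis. g b (f b))" for f
    by (intro prod.cong) auto
  have m: "(\<lambda>x::'a. \<Prod>b\<in>Basis. g b (x \<bullet> b)) \<in> borel_measurable borel"
    by measurable
  have T: "(\<lambda>f. \<Sum>b\<in>Basis. f b *\<^sub>R b) \<in> (\<Pi>\<^sub>M b\<in>(Basis::'a set). (lborel::real measure)) \<rightarrow>\<^sub>M borel"
    by measurable
  show "integrable lborel (\<lambda>x. \<Prod>b\<in>Basis. g b (x \<bullet> b))"
    unfolding lborel_eq[where 'a='a] by (subst integrable_distr_eq[OF T m]) (simp only: eq, intro product_integrable_prod g finite_Basis)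
  show "(\<integral>x. (\<Prod>b\<in>Basis. g b (x \<bullet> b)) \<partial>lborel) = (\<Prod>b\<in>Basis. \<integral>t. g b t \<partial>lborel)"
    unfolding lborel_eq[where 'a='a] by (subst integral_distr[OF T m]) (simp only: eq, intro product_integral_prod g finite_Basis)
qed

text \<open>This is the characteristic function of the standard normal law at
  \<open>- (sqrt 2 * w)\<close>, after the substitution y = sqrt 2 x. The factor 2 in the phase is
  the one that arises in \<open>gaussian_pair\<close>.\<close>

lemma gaussian_fourier_real:
  fixes w :: real
  defines "h \<equiv> \<lambda>x. exp (complex_of_real (- (x * x)) - 2 * \<i> * complex_of_real (x * w))"
  shows integrable_gaussian_fourier_real: "integrable lborel h"
    and integral_gaussian_fourier_real: "(\<integral>x. h x \<partial>lborel) = complex_of_real (sqrt pi * exp (- (w * w)))"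
proof -
  let ?t = "- (sqrt 2 * w)"
  let ?d = "\<lambda>y. std_normal_density y *\<^sub>R iexp (?t * y)"
  have m: "h \<in> borel_measurable borel" unfolding h_def by measurable
  have d: "?d (0 + sqrt 2 * x) = complex_of_real (1 / sqrt (2 * pi)) * h x" for x
  proof -
    have "\<i> * complex_of_real (?t * (sqrt 2 * x)) = - (2 * \<i> * complex_of_real (x * w))"
      by (simp add: field_simps)
    moreover have "(sqrt 2 * x)\<^sup>2 / 2 = x * x" by (simp add: power_mult_distrib power2_eq_square)
    ultimately show ?thesis
      unfolding std_normal_density_def h_def scaleR_conv_of_real
      by (simp add: exp_diff exp_minus exp_of_real field_simps flip: exp_of_real)
  qed
  have norm: "integrable lborel ?d"
    by (rule Bochner_Integration.integrable_bound[OF integrable_normal_density[of 1 0]])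
       (auto simp: normal_density_nonneg norm_exp_i_times)
  have "integrable lborel (\<lambda>x. complex_of_real (1 / sqrt (2 * pi)) * h x)"
    using lborel_integrable_real_affine[OF norm, of "sqrt 2" 0] by (simp only: d) simp
  then have "integrable lborel (\<lambda>x. complex_of_real (sqrt (2 * pi)) * (complex_of_real (1 / sqrt (2 * pi)) * h x))"
    by (rule integrable_mult_right)
  then show "integrable lborel h" by simp
  have "complex_of_real (exp (- (?t\<^sup>2) / 2)) = char std_normal_distribution ?t"
    by (simp add: char_std_normal_distribution)
  also have "\<dots> = (\<integral>y. ?d y \<partial>lborel)"
    unfolding char_def by (subst integral_density) (auto simp: normal_density_nonneg)
  also have "\<dots> = sqrt 2 *\<^sub>R (\<integral>x. complex_of_real (1 / sqrt (2 * pi)) * h x \<partial>lborel)"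
    by (subst lborel_integral_real_affine[of "sqrt 2" _ 0]) (simp_all only: d, simp_all)
  also have "\<dots> = complex_of_real (1 / sqrt pi) * (\<integral>x. h x \<partial>lborel)"
    by (simp add: scaleR_conv_of_real real_sqrt_mult)
  finally show "(\<integral>x. h x \<partial>lborel) = complex_of_real (sqrt pi * exp (- (w * w)))"
    by (simp add: field_simps power_mult_distrib power2_eq_square)
qed

lemma gaussian_fourier:
  fixes w :: "'a::euclidean_space"
  defines "h \<equiv> \<lambda>v. exp (complex_of_real (- (v \<bullet> v)) - 2 * \<i> * complex_of_real (v \<bullet> w))"
  shows integrable_gaussian_fourier: "integrable lborel h"
    and integral_gaussian_fourier:
      "(\<integral>v. h v \<partial>lborel) = complex_of_real (sqrt pi ^ DIM('a) * exp (- (w \<bullet> w)))"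
proof -
  have h: "h = (\<lambda>v. \<Prod>b\<in>Basis. exp (complex_of_real (- ((v \<bullet> b) * (v \<bullet> b))) - 2 * \<i> * complex_of_real ((v \<bullet> b) * (w \<bullet> b))))"
  proof
    fix v :: 'a
    have "complex_of_real (- (v \<bullet> v)) - 2 * \<i> * complex_of_real (v \<bullet> w)
      = (\<Sum>b\<in>Basis. complex_of_real (- ((v \<bullet> b) * (v \<bullet> b))) - 2 * \<i> * complex_of_real ((v \<bullet> b) * (w \<bullet> b)))"
      unfolding euclidean_inner[of v v] euclidean_inner[of v w]
      by (simp add: sum_subtractf sum_negf sum_distrib_left)
    then show "h v = (\<Prod>b\<in>Basis. exp (complex_of_real (- ((v \<bullet> b) * (v \<bullet> b))) - 2 * \<i> * complex_of_real ((v \<bullet> b) * (w \<bullet> b))))"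
      unfolding h_def by (simp only: exp_sum finite_Basis)
  qed
  show "integrable lborel h"
    unfolding h by (intro integrable_lborel_prod_Basis integrable_gaussian_fourier_real)
  have "(\<integral>v. h v \<partial>lborel) = (\<Prod>b\<in>Basis. complex_of_real (sqrt pi * exp (- ((w \<bullet> b) * (w \<bullet> b)))))"
    unfolding h by (subst integral_lborel_prod_Basis) (simp_all add: integrable_gaussian_fourier_real integral_gaussian_fourier_real
       del: of_real_mult of_real_minus)
  also have "\<dots> = complex_of_real (sqrt pi ^ DIM('a) * exp (- (w \<bullet> w)))"
    unfolding euclidean_inner[of w w] of_real_prod[symmetric] prod.distrib
    by (simp add: exp_sum sum_negf[symmetric])
  finally show "(\<integral>v. h v \<partial>lborel) = complex_of_real (sqrt pi ^ DIM('a) * exp (- (w \<bullet> w)))" .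
qed

subsection \<open>Linear changes of variables\<close>

text \<open>The library computes the volume of a linear image of a set in \<open>real ^ 'n\<close> only for well-ordered
  index types. The copy \<open>'a wo\<close> of a finite type, ordered by an arbitrary enumeration, carries
  this over to every finite index type.\<close>

typedef 'a wo = "UNIV :: 'a set" by simp

instance wo :: (finite) finite
proof
  have "range Abs_wo = (UNIV :: 'a wo set)"
    using type_definition.Abs_image[OF type_definition_wo] .
  then show "finite (UNIV :: 'a wo set)"
    using finite_imageI[of "UNIV :: 'a set" Abs_wo] by simp
qed

instantiation wo :: (finite) wellorder
begin

definition less_eq_wo :: "'a wo \<Rightarrow> 'a wo \<Rightarrow> bool" where
  "x \<le> y \<longleftrightarrow> to_nat (Rep_wo x) \<le> to_nat (Rep_wo y)"

definition less_wo :: "'a wo \<Rightarrow> 'a wo \<Rightarrow> bool" where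
  "x < y \<longleftrightarrow> to_nat (Rep_wo x) < to_nat (Rep_wo y)"

instance
proof
  fix P :: "'a wo \<Rightarrow> bool" and a
  assume step: "\<And>x. (\<And>y. y < x \<Longrightarrow> P y) \<Longrightarrow> P x"
  show "P a"
  proof (induction a rule: measure_induct_rule[of "\<lambda>x. to_nat (Rep_wo x)"])
    case (less x)
    show ?case by (rule step, rule less.IH) (simp only: less_wo_def)
  qed
qed (auto simp: less_eq_wo_def less_wo_def Rep_wo_inject)

end

section \<open>Permutations and determinants under relabelling of indices\<close>

lemma bij_Rep_wo: "bij Rep_wo"
  by (metis Abs_wo_inverse Rep_wo_inverse UNIV_I bij_iff)

text \<open>Conjugation turns the transposition of a and b into that of their preimages, so a
  factorisation into transpositions is carried over factor by factor with its length
  unchanged.\<close>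

lemma swapidseq_conj:
  fixes f :: "'m \<Rightarrow> 'n"
  assumes "bij f" "swapidseq n p"
  shows "swapidseq n (inv f \<circ> p \<circ> f)"
  using assms(2)
proof (induction rule: swapidseq.induct)
  case id
  then show ?case using \<open>bij f\<close> by (simp add: bij_is_inj fun_eq_iff)
next
  case (comp_Suc n p a b)
  have "inv f \<circ> (Transposition.transpose a b \<circ> p) \<circ> f = (inv f \<circ> Transposition.transpose a b \<circ> f) \<circ> (inv f \<circ> p \<circ> f)"
    using \<open>bij f\<close> by (auto simp: fun_eq_iff bij_is_surj surj_f_inv_f)
  also have "inv f \<circ> Transposition.transpose a b \<circ> f = Transposition.transpose (inv f a) (inv f b)"
    using \<open>bij f\<close> by (auto simp: fun_eq_iff Transposition.transpose_def bij_is_surj surj_f_inv_f bij_is_inj)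
  finally show ?case
    by (simp only:) (intro swapidseq.comp_Suc comp_Suc.IH, metis \<open>bij f\<close> \<open>a \<noteq> b\<close> bij_is_surj surj_f_inv_f)
qed

lemma sign_conj:
  fixes f :: "'m::finite \<Rightarrow> 'n::finite"
  assumes f: "bij f" and p: "p permutes UNIV"
  shows "sign (inv f \<circ> p \<circ> f) = sign p"
proof -
  have "permutation p" using p by (simp add: permutation_permutes) (metis finite_class.finite_UNIV)
  then obtain n where n: "swapidseq n p" by (auto simp: permutation_def)
  show ?thesis
    using evenperm_unique[OF n refl] evenperm_unique[OF swapidseq_conj[OF f n] refl] by (simp add: sign_def)
qed

text \<open>Conjugation by \<open>f\<close> matches the permutations in the two Leibniz sums. It
  preserves signs and merely reorders the factors of each product.\<close>

lemma det_reindex: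
  fixes A :: "real ^ 'n ^ 'n" and f :: "'m::finite \<Rightarrow> 'n"
  assumes f: "bij f"
  shows "det (\<chi> i j. A $ f i $ f j) = det A"
  unfolding det_def
proof (rule sum.reindex_bij_witness[where i = "\<lambda>p. inv f \<circ> p \<circ> f" and j = "\<lambda>p. f \<circ> p \<circ> inv f"])
  note [simp] = f bij_is_surj[OF f] bij_is_inj[OF f] surj_f_inv_f
  have bi [simp]: "bij (inv f)" by (simp add: bij_imp_bij_inv)
  fix p :: "'n \<Rightarrow> 'n" assume "p \<in> {p. p permutes UNIV}"
  then have p: "p permutes UNIV" by simp
  show "f \<circ> (inv f \<circ> p \<circ> f) \<circ> inv f = p" by (simp add: fun_eq_iff)
  show "inv f \<circ> p \<circ> f \<in> {p. p permutes UNIV}"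
    using permutes_bij[OF p] f by (auto intro!: bij_imp_permutes bij_comp bij_imp_bij_inv simp del: o_apply)
next
  note [simp] = f bij_is_surj[OF f] bij_is_inj[OF f] surj_f_inv_f
  fix p :: "'m \<Rightarrow> 'm" assume "p \<in> {p. p permutes UNIV}"
  then have p: "p permutes UNIV" by simp
  show e: "inv f \<circ> (f \<circ> p \<circ> inv f) \<circ> f = p" by (simp add: fun_eq_iff)
  show q: "f \<circ> p \<circ> inv f \<in> {p. p permutes UNIV}"
    using permutes_bij[OF p] f by (auto intro!: bij_imp_permutes bij_comp bij_imp_bij_inv simp del: o_apply)
  have s: "sign (f \<circ> p \<circ> inv f) = sign p"
    using sign_conj[OF f, of "f \<circ> p \<circ> inv f"] q e by simp
  have "(\<Prod>i\<in>UNIV. A $ i $ (f \<circ> p \<circ> inv f) i) = (\<Prod>i\<in>UNIV. A $ f i $ f (p i))"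
    by (subst prod.reindex_bij_betw[OF f, symmetric]) simp
  then show "of_int (sign (f \<circ> p \<circ> inv f)) * (\<Prod>i\<in>UNIV. A $ i $ (f \<circ> p \<circ> inv f) i) =
      of_int (sign p) * (\<Prod>i\<in>UNIV. (\<chi> i j. A $ f i $ f j) $ i $ p i)"
    using s by simp
qed

section \<open>Lebesgue measure under invertible linear maps\<close>

lemma prod_Basis_vec:
  fixes g :: "real ^ 'n \<Rightarrow> real"
  shows "prod g Basis = (\<Prod>i\<in>UNIV. g (axis i 1))"
proof -
  have B: "(Basis :: (real ^ 'n) set) = range (\<lambda>i. axis i 1)" by (auto simp: Basis_vec_def)
  have "inj (\<lambda>i :: 'n. axis i (1::real))" by (simp add: inj_on_def axis_eq_axis)
  then show ?thesis unfolding B by (simp add: prod.reindex)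
qed

lemma in_Basis_vec: "b \<in> (Basis :: (real ^ 'n) set) \<longleftrightarrow> (\<exists>i. b = axis i 1)"
  by (auto simp: Basis_vec_def)

lemma matrix_inv_inverse:
  fixes A :: "real ^ 'n ^ 'n"
  assumes "det A \<noteq> 0"
  shows matrix_mul_matrix_inv: "A ** matrix_inv A = mat 1"
    and matrix_inv_matrix_mul: "matrix_inv A ** A = mat 1"
proof -
  have "\<exists>B. A ** B = mat 1 \<and> B ** A = mat 1"
    using assms unfolding invertible_det_nz[symmetric] invertible_def .
  then have "A ** matrix_inv A = mat 1 \<and> matrix_inv A ** A = mat 1"
    unfolding matrix_inv_def by (rule someI_ex)
  then show "A ** matrix_inv A = mat 1" "matrix_inv A ** A = mat 1" by auto
qed

text \<open>Lebesgue measure is determined by its values on boxes. The preimage of a box under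
  \<open>A\<close> is its image under the inverse matrix, and the density cancels the determinant
  that this image contributes.\<close>

lemma lborel_distr_matrix_wellorder:
  fixes A :: "real ^ 'n::{finite,wellorder} ^ 'n::_"
  assumes A: "det A \<noteq> 0"
  shows "lborel = density (distr lborel borel ((*v) A)) (\<lambda>_. ennreal \<bar>det A\<bar>)"
proof (rule lborel_eqI)
  have inv: "A ** matrix_inv A = mat 1" "matrix_inv A ** A = mat 1"
    using matrix_inv_inverse[OF A] by simp_all
  fix l u :: "real ^ 'n::_" assume lu: "\<And>b. b \<in> Basis \<Longrightarrow> l \<bullet> b \<le> u \<bullet> b"
  have [measurable]: "(*v) A \<in> borel_measurable borel"
    by (intro borel_measurable_continuous_onI continuous_intros)
  have pre: "(*v) A -` box l u = (*v) (matrix_inv A) ` box l u"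
  proof (intro set_eqI iffI)
    fix x assume "x \<in> (*v) A -` box l u"
    moreover have "x = matrix_inv A *v (A *v x)" by (simp add: matrix_vector_mul_assoc inv)
    ultimately show "x \<in> (*v) (matrix_inv A) ` box l u" by blast
  qed (auto simp: matrix_vector_mul_assoc inv)
  have lm: "(*v) (matrix_inv A) ` box l u \<in> lmeasurable"
    by (intro measurable_linear_image) auto
  have dd: "\<bar>det A\<bar> * \<bar>det (matrix_inv A)\<bar> = 1"
    using arg_cong[OF inv(1), of det] by (simp add: det_mul flip: abs_mult)
  have bs: "(*v) A -` box l u \<in> sets borel"
    using measurable_sets[OF \<open>(*v) A \<in> borel_measurable borel\<close>, of "box l u"] by simp
  have "emeasure lborel ((*v) A -` box l u) = emeasure lebesgue ((*v) A -` box l u)"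
    using bs by simp
  also have "\<dots> = ennreal (measure lebesgue ((*v) (matrix_inv A) ` box l u))"
    unfolding pre using lm by (simp add: emeasure_eq_measure2)
  also have "\<dots> = ennreal (\<bar>det (matrix_inv A)\<bar> * measure lebesgue (box l u))"
    by (subst measure_linear_image) auto
  finally have e: "emeasure lborel ((*v) A -` box l u) = ennreal (\<bar>det (matrix_inv A)\<bar> * measure lebesgue (box l u))" .
  have "emeasure (density (distr lborel borel ((*v) A)) (\<lambda>_. ennreal \<bar>det A\<bar>)) (box l u)
      = ennreal \<bar>det A\<bar> * emeasure lborel ((*v) A -` box l u)"
    by (simp add: emeasure_density nn_integral_cmult emeasure_distr)
  also have "\<dots> = ennreal (measure lebesgue (box l u))"
    unfolding e by (simp add: ennreal_mult[symmetric] mult.assoc[symmetric] dd)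
  also have "\<dots> = ennreal (\<Prod>b\<in>Basis. (u - l) \<bullet> b)"
    using lu by (simp add: measure_lborel_box_eq)
  finally show "emeasure (density (distr lborel borel ((*v) A)) (\<lambda>_. ennreal \<bar>det A\<bar>)) (box l u)
      = (\<Prod>b\<in>Basis. (u - l) \<bullet> b)" .
qed simp

lemma lborel_distr_reindex:
  fixes f :: "'m::finite \<Rightarrow> 'n::finite"
  assumes f: "bij f"
  shows "(lborel :: (real ^ 'm) measure) = distr lborel borel (\<lambda>x :: real ^ 'n. \<chi> i. x $ f i)"
proof (rule lborel_eqI)
  fix l u :: "real ^ 'm" assume lu: "\<And>b. b \<in> Basis \<Longrightarrow> l \<bullet> b \<le> u \<bullet> b"
  have lu': "l $ i \<le> u $ i" for i using lu[of "axis i 1"] by (simp add: inner_axis)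
  have [measurable]: "(\<lambda>x :: real ^ 'n. (\<chi> i. x $ f i) :: real ^ 'm) \<in> borel_measurable borel"
    by (intro borel_measurable_continuous_onI continuous_intros)
  let ?l = "(\<chi> i. l $ inv f i) :: real ^ 'n" and ?u = "(\<chi> i. u $ inv f i) :: real ^ 'n"
  have pre: "(\<lambda>x :: real ^ 'n. (\<chi> i. x $ f i) :: real ^ 'm) -` box l u = box ?l ?u"
    using f by (auto simp: mem_box_cart) (metis bij_is_surj surj_f_inv_f, metis bij_is_surj surj_f_inv_f, metis bij_is_inj inv_f_f, metis bij_is_inj inv_f_f)
  have "emeasure (distr lborel borel (\<lambda>x :: real ^ 'n. (\<chi> i. x $ f i) :: real ^ 'm)) (box l u) = emeasure lborel (box ?l ?u)"
    by (simp add: emeasure_distr pre)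
  also have "\<dots> = ennreal (\<Prod>i\<in>UNIV. u $ inv f i - l $ inv f i)"
    using lu' by (subst emeasure_lborel_box_eq) (auto simp: prod_Basis_vec inner_axis in_Basis_vec)
  also have "(\<Prod>i\<in>UNIV. u $ inv f i - l $ inv f i) = (\<Prod>i\<in>UNIV. u $ i - l $ i)"
    by (rule prod.reindex_bij_betw[OF bij_imp_bij_inv[OF f], of "\<lambda>i. u $ i - l $ i"])
  also have "\<dots> = (\<Prod>b\<in>Basis. (u - l) \<bullet> b)" by (simp add: prod_Basis_vec inner_axis)
  finally show "emeasure (distr lborel borel (\<lambda>x :: real ^ 'n. (\<chi> i. x $ f i) :: real ^ 'm)) (box l u)
      = (\<Prod>b\<in>Basis. (u - l) \<bullet> b)" .
qed simp

text \<open>\<open>A\<close> factors as the relabelling \<open>?r\<close>, the relabelled matrix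
  \<open>?A\<close> and the relabelling back \<open>?s\<close>. Both relabellings preserve Lebesgue
  measure, and \<open>?A\<close> has the determinant of \<open>A\<close>.\<close>

lemma lborel_distr_matrix:
  fixes A :: "real ^ 'n ^ 'n"
  assumes A: "det A \<noteq> 0"
  shows "lborel = density (distr lborel borel ((*v) A)) (\<lambda>_. ennreal \<bar>det A\<bar>)"
proof -
  let ?A = "(\<chi> i j. A $ Rep_wo i $ Rep_wo j) :: real ^ 'n wo ^ 'n wo"
  let ?r = "\<lambda>x :: real ^ 'n. (\<chi> i. x $ Rep_wo i) :: real ^ 'n wo"
  let ?s = "\<lambda>x :: real ^ 'n wo. (\<chi> i. x $ Abs_wo i) :: real ^ 'n"
  have d: "det ?A = det A" by (rule det_reindex[OF bij_Rep_wo])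
  have bA: "bij (Abs_wo :: 'n \<Rightarrow> 'n wo)"
    by (metis Abs_wo_inverse Rep_wo_inverse UNIV_I bij_iff)
  have m [measurable]: "?r \<in> borel_measurable borel" "?s \<in> borel_measurable borel"
      "(*v) A \<in> borel_measurable borel" "(*v) ?A \<in> borel_measurable borel"
    by (intro borel_measurable_continuous_onI continuous_intros)+
  have conj: "?s (?A *v ?r x) = A *v x" for x
    by (simp add: vec_eq_iff matrix_vector_mult_def Abs_wo_inverse)
       (intro allI sum.reindex_bij_betw[OF bij_Rep_wo])
  have "lborel = distr (lborel :: (real ^ 'n wo) measure) borel ?s"
    by (rule lborel_distr_reindex[OF bA])
  also have "\<dots> = distr (density (distr lborel borel ((*v) ?A)) (\<lambda>_. ennreal \<bar>det A\<bar>)) borel ?s"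
    using lborel_distr_matrix_wellorder[of ?A] A d by simp
  also have "\<dots> = density (distr (distr lborel borel ((*v) ?A)) borel ?s) (\<lambda>_. ennreal \<bar>det A\<bar>)"
    by (rule measure_eqI) (simp_all add: emeasure_distr emeasure_density_const measurable_sets_borel[OF m(2)])
  also have "distr (distr lborel borel ((*v) ?A)) borel ?s
    = distr (distr (distr lborel borel ?r) borel ((*v) ?A)) borel ?s"
    using lborel_distr_reindex[OF bij_Rep_wo] by metis
  also have "\<dots> = distr lborel borel ((*v) A)"
    by (simp add: distr_distr comp_def conj)
  finally show ?thesis .
qed

lemma matrix_change_of_variables:
  fixes A :: "real ^ 'n ^ 'n" and h :: "real ^ 'n \<Rightarrow> complex"
  assumes A: "det A \<noteq> 0" and h [measurable]: "h \<in> borel_measurable borel"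
  shows integrable_matrix_iff: "integrable lborel (\<lambda>x. h (A *v x)) \<longleftrightarrow> integrable lborel h"
    and integral_matrix: "(\<integral>x. h x \<partial>lborel) = of_real \<bar>det A\<bar> * (\<integral>x. h (A *v x) \<partial>lborel)"
proof -
  have m [measurable]: "(*v) A \<in> borel_measurable borel"
    by (intro borel_measurable_continuous_onI continuous_intros)
  show "integrable lborel (\<lambda>x. h (A *v x)) \<longleftrightarrow> integrable lborel h"
  proof -
    have "integrable lborel h \<longleftrightarrow> integrable lborel (\<lambda>x. complex_of_real \<bar>det A\<bar> * h (A *v x))"
    proof -
      have "integrable lborel h \<longleftrightarrow> integrable (density (distr lborel borel ((*v) A)) (\<lambda>_. ennreal \<bar>det A\<bar>)) h"
        using lborel_distr_matrix[OF A] by metis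
      also have "\<dots> \<longleftrightarrow> integrable lborel (\<lambda>x. complex_of_real \<bar>det A\<bar> * h (A *v x))"
        by (simp add: integrable_density integrable_distr_eq scaleR_conv_of_real)
      finally show ?thesis .
    qed
    also have "\<dots> \<longleftrightarrow> integrable lborel (\<lambda>x. h (A *v x))"
    proof
      let ?c = "complex_of_real \<bar>det A\<bar>"
      assume "integrable lborel (\<lambda>x. ?c * h (A *v x))"
      then have "integrable lborel (\<lambda>x. inverse ?c * (?c * h (A *v x)))"
        by (rule integrable_mult_right)
      moreover have "inverse ?c * (?c * z) = z" for z using A by (simp add: field_simps)
      ultimately show "integrable lborel (\<lambda>x. h (A *v x))" by (simp only:)
    qed (rule integrable_mult_right)
    finally show ?thesis ..
  qed
  show "(\<integral>x. h x \<partial>lborel) = of_real \<bar>det A\<bar> * (\<integral>x. h (A *v x) \<partial>lborel)"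
  proof -
    have "(\<integral>x. h x \<partial>lborel) = (\<integral>x. h x \<partial>density (distr lborel borel ((*v) A)) (\<lambda>_. ennreal \<bar>det A\<bar>))"
      using lborel_distr_matrix[OF A] by metis
    also have "\<dots> = of_real \<bar>det A\<bar> * (\<integral>x. h (A *v x) \<partial>lborel)"
      by (simp add: integral_density integral_distr scaleR_conv_of_real)
    finally show ?thesis .
  qed
qed

subsection \<open>Matrices with positive definite symmetric part\<close>

text \<open>Gram-Schmidt for the inner product given by the symmetric part of \<open>A\<close>: the
  columns of \<open>B\<close> are an orthonormal basis for it. The antisymmetric part of the
  transformed matrix remains arbitrary, which is why the conclusion is a symmetrised
  identity.\<close>

lemma congruent_to_identity:
  fixes A :: "real ^ 'n ^ 'n"
  assumes pos: "\<And>x. x \<noteq> 0 \<Longrightarrow> 0 < x \<bullet> (A *v x)"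
  obtains B where "det B \<noteq> 0"
    and "\<And>u v. (B *v u) \<bullet> (A *v (B *v v)) + (B *v v) \<bullet> (A *v (B *v u)) = 2 * (u \<bullet> v)"
proof -
  define s where "s x y = x \<bullet> (A *v y) + y \<bullet> (A *v x)" for x y
  have s_comm: "s x y = s y x" for x y by (simp add: s_def)
  have s_alt: "s x y = (A *v x + x v* A) \<bullet> y" for x y
    using dot_lmul_matrix[of x A y] by (simp add: s_def inner_add_left inner_add_right inner_commute)
  have "\<exists>b :: 'n \<Rightarrow> real ^ 'n. \<forall>i\<in>I. \<forall>j\<in>I. s (b i) (b j) = (if i = j then 2 else 0)" for I :: "'n set"
    using finite[of I]
  proof (induction I rule: finite_induct)
    case empty
    then show ?case by simp
  next
    case (insert k I)
    then obtain b :: "'n \<Rightarrow> real ^ 'n"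
      where b: "\<And>i j. i \<in> I \<Longrightarrow> j \<in> I \<Longrightarrow> s (b i) (b j) = (if i = j then 2 else 0)" by blast
    \<comment> \<open>By \<open>s_alt\<close> these vectors represent the functionals
      \<open>s (b i)\<close>. There are fewer of them than the dimension, so some nonzero vector is
      orthogonal to all, which means \<open>s\<close>-orthogonal to every \<open>b i\<close> built
      so far.\<close>
    let ?W = "(\<lambda>i. A *v b i + b i v* A) ` I"
    have "dim ?W \<le> card I"
      by (rule order_trans[OF dim_le_card' card_image_le]) simp_all
    also have "card I < CARD('n)"
      using insert.hyps by (intro psubset_card_mono) auto
    finally obtain x where x: "x \<noteq> 0" "\<And>y. y \<in> span ?W \<Longrightarrow> orthogonal x y"
      using orthogonal_to_subspace_exists[of ?W] by auto
    have sx: "s (b i) x = 0" if "i \<in> I" for i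
    proof -
      have "orthogonal x (A *v b i + b i v* A)"
        by (rule x(2), rule span_base) (use that in blast)
      then show ?thesis unfolding s_alt orthogonal_def by (simp only: inner_commute)
    qed
    \<comment> \<open>Since \<open>s x x\<close> is twice \<open>x \<bullet> (A *v x)\<close>, this
      scaling makes \<open>s y y\<close> equal to 2.\<close>
    define y where "y = (1 / sqrt (x \<bullet> (A *v x))) *\<^sub>R x"
    have px: "0 < x \<bullet> (A *v x)" using pos x by simp
    have yy: "s y y = 2"
      using px by (simp add: y_def s_def matrix_vector_mult_scaleR flip: real_sqrt_mult)
    have sy: "s (b i) y = 0" if "i \<in> I" for i
      using sx[OF that] by (simp add: s_alt y_def)
    have sy': "s y (b i) = 0" if "i \<in> I" for i
      using sy[OF that] s_comm by metis
    have "s ((b(k := y)) i) ((b(k := y)) j) = (if i = j then 2 else 0)"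
      if "i \<in> insert k I" "j \<in> insert k I" for i j
      using that insert.hyps by (auto simp: yy sy sy' b)
    then show ?case by blast
  qed
  from this[of UNIV] obtain b :: "'n \<Rightarrow> real ^ 'n"
    where b: "\<And>i j. s (b i) (b j) = (if i = j then 2 else 0)" by auto
  define B :: "real ^ 'n ^ 'n" where "B = (\<chi> i j. b j $ i)"
  have Bax: "B *v axis i 1 = b i" for i
    unfolding matrix_vector_mult_basis by (simp add: B_def column_def vec_eq_iff)
  define C where "C = transpose B ** A ** B"
  have C: "u \<bullet> (C *v v) = (B *v u) \<bullet> (A *v (B *v v))" for u v
    unfolding C_def by (metis dot_lmul_matrix matrix_vector_mul_assoc transpose_matrix_vector transpose_transpose)
  have "C $ i $ j + C $ j $ i = (if i = j then 2 else 0)" for i j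
  proof -
    have "C $ i $ j = axis i 1 \<bullet> (C *v axis j 1)" for i j
      unfolding matrix_vector_mult_basis by (simp add: column_def inner_axis')
    then show ?thesis using b[of i j] by (simp add: C Bax s_def)
  qed
  then have CC: "C + transpose C = 2 *\<^sub>R mat 1"
    by (simp add: vec_eq_iff transpose_def mat_def)
  have eq: "(B *v u) \<bullet> (A *v (B *v v)) + (B *v v) \<bullet> (A *v (B *v u)) = 2 * (u \<bullet> v)" for u v
  proof -
    have "v \<bullet> (C *v u) = u \<bullet> (transpose C *v v)"
      using dot_lmul_matrix[of v C u] by (simp add: inner_commute[of u])
    then have "u \<bullet> (C *v v) + v \<bullet> (C *v u) = u \<bullet> ((C + transpose C) *v v)"
      by (simp only: matrix_vector_mult_add_rdistrib inner_add_right)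
    also have "\<dots> = 2 * (u \<bullet> v)"
      unfolding CC by (simp add: scaleR_matrix_vector_assoc[symmetric])
    finally show ?thesis by (simp add: C)
  qed
  have "u = 0" if "B *v u = 0" for u
    using eq[of u u] that by simp
  then have "\<exists>B'. B' ** B = mat 1"
    by (simp add: matrix_left_invertible_ker)
  then have "det B \<noteq> 0"
    by (simp add: invertible_det_nz[symmetric] invertible_left_inverse)
  then show ?thesis using eq by (rule that)
qed

lemma det_nonzero_if_definite:
  fixes A :: "real ^ 'n ^ 'n"
  assumes "\<And>x. x \<noteq> 0 \<Longrightarrow> 0 < x \<bullet> (A *v x)"
  shows "det A \<noteq> 0"
proof -
  have "x = 0" if "A *v x = 0" for x
    using assms[of x] that by auto
  then have "\<exists>B. B ** A = mat 1"
    by (simp add: matrix_left_invertible_ker)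
  then show ?thesis
    by (simp add: invertible_det_nz[symmetric] invertible_left_inverse)
qed

text \<open>The segment from the identity to \<open>A\<close> consists of definite matrices. Their
  determinants do not vanish, so the sign cannot change along the segment.\<close>

lemma det_pos_if_definite:
  fixes A :: "real ^ 'n ^ 'n"
  assumes pos: "\<And>x. x \<noteq> 0 \<Longrightarrow> 0 < x \<bullet> (A *v x)"
  shows "0 < det A"
proof (rule ccontr)
  assume "\<not> 0 < det A"
  let ?P = "\<lambda>t. (1 - t) *\<^sub>R mat 1 + t *\<^sub>R A"
  have "continuous_on {0..1} (\<lambda>t. det (?P t))"
    unfolding det_def by (intro continuous_intros) 
  then obtain t where t: "0 \<le> t" "t \<le> 1" "det (?P t) = 0"
    using IVT2'[of "\<lambda>t. det (?P t)" 1 0 0] \<open>\<not> 0 < det A\<close> by auto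
  have "0 < x \<bullet> (?P t *v x)" if "x \<noteq> 0" for x
  proof -
    have "x \<bullet> (?P t *v x) = (1 - t) * (x \<bullet> x) + t * (x \<bullet> (A *v x))"
      by (simp add: matrix_vector_mult_add_rdistrib inner_add_right scaleR_matrix_vector_assoc[symmetric])
    moreover have "0 < x \<bullet> x" "0 < x \<bullet> (A *v x)" using that pos by auto
    ultimately show ?thesis using t by (cases "t = 0") (auto intro: add_nonneg_pos)
  qed
  then show False using det_nonzero_if_definite t(3) by blast
qed

text \<open>The quadratic form attains a positive minimum on the unit sphere; half of it is
  subtracted so that strict positivity remains. The margin \<open>e\<close> later pays for the
  growth of \<open>f\<close>.\<close>

lemma definite_coercive:
  fixes A :: "real ^ 'n ^ 'n"
  assumes pos: "\<And>x. x \<noteq> 0 \<Longrightarrow> 0 < x \<bullet> (A *v x)"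
  obtains e where "0 < e" "\<And>x. x \<noteq> 0 \<Longrightarrow> 0 < x \<bullet> ((A - e *\<^sub>R mat 1) *v x)"
proof -
  let ?S = "sphere (0 :: real ^ 'n) 1"
  have "continuous_on ?S (\<lambda>x. x \<bullet> (A *v x))" by (intro continuous_intros)
  moreover have "axis undefined 1 \<in> ?S" by simp
  ultimately obtain z where z: "z \<in> ?S" "\<And>x. x \<in> ?S \<Longrightarrow> z \<bullet> (A *v z) \<le> x \<bullet> (A *v x)"
    using continuous_attains_inf[of ?S "\<lambda>x. x \<bullet> (A *v x)"] by fastforce
  let ?c = "z \<bullet> (A *v z)"
  have c: "0 < ?c" using z(1) by (intro pos) auto
  have "0 < x \<bullet> ((A - (?c / 2) *\<^sub>R mat 1) *v x)" if "x \<noteq> 0" for x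
  proof -
    let ?y = "(1 / norm x) *\<^sub>R x"
    have "?c \<le> ?y \<bullet> (A *v ?y)" using that by (intro z(2)) simp
    also have "\<dots> = (x \<bullet> (A *v x)) / (norm x)\<^sup>2"
      by (simp add: matrix_vector_mult_scaleR power2_eq_square)
    finally have "?c * (x \<bullet> x) \<le> x \<bullet> (A *v x)"
      using that by (simp add: field_simps dot_square_norm)
    moreover have "x \<bullet> ((A - (?c / 2) *\<^sub>R mat 1) *v x) = x \<bullet> (A *v x) - ?c / 2 * (x \<bullet> x)"
      by (simp add: matrix_vector_mult_diff_rdistrib inner_diff_right scaleR_matrix_vector_assoc[symmetric])
    moreover have "0 < ?c * (x \<bullet> x)" using c that by simp
    ultimately show ?thesis by simp
  qed
  then show ?thesis using c that[of "?c / 2"] by simp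
qed

subsection \<open>The complex Gaussian integral\<close>

definition complex_vec :: "(real ^ 'n) \<times> (real ^ 'n) \<Rightarrow> complex ^ 'n" where
  "complex_vec z = (\<chi> i. Complex (fst z $ i) (snd z $ i))"

lemma complex_vec_measurable [measurable]: "complex_vec \<in> borel_measurable borel"
  unfolding complex_vec_def Complex_eq
  by (intro borel_measurable_continuous_onI continuous_intros)

text \<open>The real basis of the complex space consists of the vectors \<open>axis i 1\<close> and
  \<open>axis i \<i>\<close>. A box is therefore a product of a box of real parts and a box of
  imaginary parts, and its volume factors accordingly.\<close>

lemma lborel_complex_vec:
  "(lborel :: (complex ^ 'n) measure) = distr (lborel \<Otimes>\<^sub>M lborel) borel complex_vec"
proof (rule lborel_eqI)
  fix l u :: "complex ^ 'n" assume lu: "\<And>b. b \<in> Basis \<Longrightarrow> l \<bullet> b \<le> u \<bullet> b"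
  have Re_le: "Re (l $ i) \<le> Re (u $ i)" and Im_le: "Im (l $ i) \<le> Im (u $ i)" for i
    using lu[of "axis i 1"] lu[of "axis i \<i>"] by (simp_all add: inner_axis)
  have B: "(Basis :: (complex ^ 'n) set) = (\<lambda>i. axis i 1) ` UNIV \<union> (\<lambda>i. axis i \<i>) ` UNIV"
    by (auto simp: Basis_vec_def Basis_complex_def)
  have pB: "prod g Basis = (\<Prod>i\<in>UNIV. g (axis i 1)) * (\<Prod>i\<in>UNIV. g (axis i \<i>))"
    for g :: "complex ^ 'n \<Rightarrow> real"
    unfolding B by (subst prod.union_disjoint) (auto simp: axis_eq_axis prod.reindex inj_on_def)
  let ?r = "\<lambda>l :: complex ^ 'n. (\<chi> i. Re (l $ i)) :: real ^ 'n"
  let ?i = "\<lambda>l :: complex ^ 'n. (\<chi> i. Im (l $ i)) :: real ^ 'n"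
  have pre: "complex_vec -` box l u = box (?r l) (?r u) \<times> box (?i l) (?i u)"
  proof -
    have "x \<in> box l u \<longleftrightarrow> (\<forall>i. Re (l $ i) < Re (x $ i) \<and> Re (x $ i) < Re (u $ i))
        \<and> (\<forall>i. Im (l $ i) < Im (x $ i) \<and> Im (x $ i) < Im (u $ i))" for x
      unfolding mem_box B ball_Un by (simp add: inner_axis)
    then show ?thesis by (auto simp: complex_vec_def mem_box_cart)
  qed
  have "emeasure (distr (lborel \<Otimes>\<^sub>M lborel) borel complex_vec) (box l u)
      = emeasure lborel (box (?r l) (?r u)) * emeasure lborel (box (?i l) (?i u))"
    by (subst emeasure_distr)
       (simp_all add: lborel_prod, simp add: pre space_pair_measure lborel.emeasure_pair_measure_Times flip: lborel_prod)
  also have "\<dots> = ennreal ((\<Prod>i\<in>UNIV. Re (u $ i) - Re (l $ i)) * (\<Prod>i\<in>UNIV. Im (u $ i) - Im (l $ i)))"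
    using Re_le Im_le
    by (subst (1 2) emeasure_lborel_box)
       (auto simp: prod_Basis_vec inner_axis in_Basis_vec prod_nonneg ennreal_mult)
  also have "\<dots> = (\<Prod>b\<in>Basis. (u - l) \<bullet> b)"
    by (simp add: pB inner_axis)
  finally show "emeasure (distr (lborel \<Otimes>\<^sub>M lborel) borel complex_vec) (box l u)
      = (\<Prod>b\<in>Basis. (u - l) \<bullet> b)" .
qed simp

lemma integrable_exp_quadratic:
  fixes A :: "real ^ 'n ^ 'n"
  assumes pos: "\<And>x. x \<noteq> 0 \<Longrightarrow> 0 < x \<bullet> (A *v x)"
  shows "integrable lborel (\<lambda>x. exp (- (x \<bullet> (A *v x))))"
proof -
  obtain B where B: "det B \<noteq> 0"
    "\<And>u v. (B *v u) \<bullet> (A *v (B *v v)) + (B *v v) \<bullet> (A *v (B *v u)) = 2 * (u \<bullet> v)"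
    using congruent_to_identity[OF pos] by metis
  have B2: "(B *v u) \<bullet> (A *v (B *v u)) = u \<bullet> u" for u using B(2)[of u u] by simp
  \<comment> \<open>The passage to complex values makes the change of variables and the Fourier
    integral at frequency 0 applicable.\<close>
  have "integrable lborel (\<lambda>x. complex_of_real (exp (- (x \<bullet> (A *v x)))))"
  proof (subst integrable_matrix_iff[OF B(1), symmetric])
    show "(\<lambda>x. complex_of_real (exp (- (x \<bullet> (A *v x))))) \<in> borel_measurable borel"
      by (intro borel_measurable_continuous_onI continuous_intros)
    show "integrable lborel (\<lambda>x. complex_of_real (exp (- ((B *v x) \<bullet> (A *v (B *v x))))))"
      using integrable_gaussian_fourier[of "0 :: real ^ 'n"] by (simp add: B2 exp_of_real[symmetric])
  qed
  then show ?thesis using complex_of_real_integrable_eq by blast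
qed

text \<open>Separates the two parts of \<open>A\<close>: the real part is a sum of quadratic forms
  in u and v, which see only the symmetric part, while the imaginary part is v paired with
  \<open>A\<close> minus its transpose applied to u.\<close>

lemma cpair_complex_vec:
  fixes A :: "real ^ 'n ^ 'n"
  shows "cpair (complex_vec (u, v)) (cmat A *v vcnj (complex_vec (u, v)))
    = Complex (u \<bullet> (A *v u) + v \<bullet> (A *v v)) (v \<bullet> (A *v u) - u \<bullet> (A *v v))"
  by (simp add: cpair_def complex_vec_def vcnj_def cmat_def matrix_vector_mult_def inner_vec_def
      complex_eq_iff sum_distrib_left sum.distrib sum_subtractf algebra_simps)

lemma gaussian_pair:
  fixes A :: "real ^ 'n ^ 'n"
  assumes pos: "\<And>x. x \<noteq> 0 \<Longrightarrow> 0 < x \<bullet> (A *v x)"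
  defines "E \<equiv> \<lambda>z. exp (- cpair (complex_vec z) (cmat A *v vcnj (complex_vec z)))"
  shows integrable_gaussian_pair: "integrable (lborel \<Otimes>\<^sub>M lborel) E"
    and integral_gaussian_pair: "(\<integral>z. E z \<partial>(lborel \<Otimes>\<^sub>M lborel)) = complex_of_real (pi ^ CARD('n) / det A)"
proof -
  have E: "E (u, v) = exp (complex_of_real (- (u \<bullet> (A *v u)) - v \<bullet> (A *v v)) 
      - \<i> * complex_of_real (v \<bullet> (A *v u) - u \<bullet> (A *v v)))" for u v
    unfolding E_def cpair_complex_vec by (rule arg_cong[of _ _ exp]) (simp add: complex_eq_iff)
  have nE: "norm (E (u, v)) = exp (- (u \<bullet> (A *v u))) * exp (- (v \<bullet> (A *v v)))" for u v
    by (simp add: E norm_exp_eq_Re flip: exp_add)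
  have cE: "E = (\<lambda>z. exp (complex_of_real (- (fst z \<bullet> (A *v fst z)) - snd z \<bullet> (A *v snd z)) 
      - \<i> * complex_of_real (snd z \<bullet> (A *v fst z) - fst z \<bullet> (A *v snd z))))"
    by (auto simp: fun_eq_iff E)
  have "E \<in> borel_measurable borel"
    unfolding cE
    by (intro borel_measurable_continuous_onI continuous_intros
        bounded_linear.continuous_on[OF matrix_vector_mul_bounded_linear])
  then have mE [measurable]: "E \<in> borel_measurable (lborel \<Otimes>\<^sub>M lborel)"
    by (simp add: lborel_prod)
  have gA: "integrable lborel (\<lambda>x. exp (- (x \<bullet> (A *v x))))"
    by (rule integrable_exp_quadratic[OF pos])
  \<comment> \<open>By \<open>nE\<close> the modulus is a product of a function of u and a function
    of v, so Fubini's criterion reduces to the one-variable Gaussian \<open>gA\<close>.\<close>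
  show iE: "integrable (lborel \<Otimes>\<^sub>M lborel) E"
  proof (rule lborel_pair.Fubini_integrable[OF mE])
    show "integrable lborel (\<lambda>u. \<integral>v. norm (E (u, v)) \<partial>lborel)"
      unfolding nE using gA by simp
    have "integrable lborel (\<lambda>v. E (u, v))" for u
    proof (rule Bochner_Integration.integrable_bound[OF integrable_mult_right[OF gA, of "exp (- (u \<bullet> (A *v u)))"]])
      show "AE v in lborel. norm (E (u, v)) \<le> norm (exp (- (u \<bullet> (A *v u))) * exp (- (v \<bullet> (A *v v))))"
        unfolding nE by simp
    qed measurable
    then show "AE u in lborel. integrable lborel (\<lambda>v. E (u, v))" by simp
  qed
  txt \<open>Substituting \<open>B\<close> in both variables turns the symmetric part of \<open>A\<close> into the identity. The
    \<open>v\<close>-integral is then a Fourier transform of the standard Gaussian at \<open>Cu - u\<close>, and since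
    $u \cdot Cu = |u|^2$ the remaining exponent $|u|^2 + |Cu - u|^2$ collapses to $|Cu|^2$.\<close>
  obtain B where B: "det B \<noteq> 0"
    "\<And>u v. (B *v u) \<bullet> (A *v (B *v v)) + (B *v v) \<bullet> (A *v (B *v u)) = 2 * (u \<bullet> v)"
    using congruent_to_identity[OF pos] by metis
  have B2: "(B *v u) \<bullet> (A *v (B *v u)) = u \<bullet> u" for u using B(2)[of u u] by simp
  define C where "C = transpose B ** A ** B"
  have C: "u \<bullet> (C *v v) = (B *v u) \<bullet> (A *v (B *v v))" for u v
    unfolding C_def by (metis dot_lmul_matrix matrix_vector_mul_assoc transpose_matrix_vector transpose_transpose)
  have dA: "0 < det A" by (rule det_pos_if_definite[OF pos])
  have dC: "det C = (det B)\<^sup>2 * det A"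
    by (simp add: C_def det_mul det_transpose power2_eq_square)
  have EB: "E (B *v u, B *v v) = complex_of_real (exp (- (u \<bullet> u)))
      * exp (complex_of_real (- (v \<bullet> v)) - 2 * \<i> * complex_of_real (v \<bullet> (C *v u - u)))" for u v
  proof -
    \<comment> \<open>The symmetrised identity replaces u paired with Cv by 2 (u . v) minus v paired
      with Cu, so the whole phase becomes linear in v with frequency Cu - u.\<close>
    have "(B *v v) \<bullet> (A *v (B *v u)) - (B *v u) \<bullet> (A *v (B *v v)) = 2 * (v \<bullet> (C *v u - u))"
      using B(2)[of u v] by (simp add: C inner_diff_right inner_commute[of v u])
    then show ?thesis
      unfolding E B2 exp_of_real[symmetric] exp_add[symmetric]
      by (intro arg_cong[of _ _ exp]) (simp add: complex_eq_iff)
  qed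
  have CC: "u \<bullet> u + (C *v u - u) \<bullet> (C *v u - u) = (C *v u) \<bullet> (C *v u)" for u
    using C[of u u] by (simp add: B2 inner_diff_left inner_diff_right inner_commute)
  have mEu [measurable]: "(\<lambda>v. E (u, v)) \<in> borel_measurable borel" for u
    using measurable_Pair2[OF mE, of u] by simp
  have in1: "(\<integral>v. E (B *v u, v) \<partial>lborel)
      = complex_of_real (\<bar>det B\<bar> * sqrt pi ^ CARD('n)) * complex_of_real (exp (- ((C *v u) \<bullet> (C *v u))))" for u
  proof -
    have "(\<integral>v. E (B *v u, v) \<partial>lborel) = complex_of_real \<bar>det B\<bar> * (\<integral>v. E (B *v u, B *v v) \<partial>lborel)"
      by (rule integral_matrix[OF B(1)]) measurable
    also have "(\<integral>v. E (B *v u, B *v v) \<partial>lborel)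
       = complex_of_real (exp (- (u \<bullet> u)) * (sqrt pi ^ CARD('n) * exp (- ((C *v u - u) \<bullet> (C *v u - u)))))"
      unfolding EB by (subst integral_mult_right_zero, subst integral_gaussian_fourier) simp
    also have "exp (- (u \<bullet> u)) * (sqrt pi ^ CARD('n) * exp (- ((C *v u - u) \<bullet> (C *v u - u))))
       = sqrt pi ^ CARD('n) * exp (- ((C *v u) \<bullet> (C *v u)))"
      unfolding CC[symmetric] by (simp add: exp_add exp_minus exp_diff field_simps)
    finally show ?thesis by simp
  qed
  have G1: "(\<integral>u. complex_of_real (exp (- ((C *v u) \<bullet> (C *v u)))) \<partial>lborel)
     = complex_of_real (sqrt pi ^ CARD('n) / \<bar>det C\<bar>)"
  proof -
    have "(\<integral>w. complex_of_real (exp (- (w \<bullet> (w :: real ^ 'n)))) \<partial>lborel)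
      = complex_of_real \<bar>det C\<bar> * (\<integral>u. complex_of_real (exp (- ((C *v u) \<bullet> (C *v u)))) \<partial>lborel)"
      by (rule integral_matrix) (use dA B(1) in \<open>auto simp: dC intro!: borel_measurable_continuous_onI continuous_intros\<close>)
    moreover have "(\<integral>w. complex_of_real (exp (- (w \<bullet> (w :: real ^ 'n)))) \<partial>lborel) = complex_of_real (sqrt pi ^ CARD('n))"
      using integral_gaussian_fourier[of "0 :: real ^ 'n"] by (simp add: exp_of_real[symmetric])
    moreover have "det C \<noteq> 0" using dA B(1) by (simp add: dC)
    ultimately show ?thesis by (simp add: field_simps)
  qed
  have "(\<integral>z. E z \<partial>(lborel \<Otimes>\<^sub>M lborel)) = (\<integral>u. (\<integral>v. E (u, v) \<partial>lborel) \<partial>lborel)"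
    using lborel_pair.integral_fst'[OF iE] by simp
  also have "\<dots> = complex_of_real \<bar>det B\<bar> * (\<integral>u. (\<integral>v. E (B *v u, v) \<partial>lborel) \<partial>lborel)"
    by (rule integral_matrix[OF B(1)]) measurable
  also have "\<dots> = complex_of_real (\<bar>det B\<bar> * (\<bar>det B\<bar> * sqrt pi ^ CARD('n)) * (sqrt pi ^ CARD('n) / \<bar>det C\<bar>))"
    unfolding in1 integral_mult_right_zero G1 by (simp only: of_real_mult mult.assoc)
  \<comment> \<open>Each of the two substitutions contributes one factor
    \<open>\<bar>det B\<bar>\<close>; both cancel against \<open>det C\<close>, which is the square
    of \<open>det B\<close> times the positive number \<open>det A\<close>.\<close>
  also have "\<bar>det B\<bar> * (\<bar>det B\<bar> * sqrt pi ^ CARD('n)) * (sqrt pi ^ CARD('n) / \<bar>det C\<bar>) = pi ^ CARD('n) / det A"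
    using dA B(1) by (simp add: dC abs_mult power2_eq_square field_simps flip: power_mult_distrib)
  finally show "(\<integral>z. E z \<partial>(lborel \<Otimes>\<^sub>M lborel)) = complex_of_real (pi ^ CARD('n) / det A)" .
qed

lemma complex_gaussian:
  fixes A :: "real ^ 'n ^ 'n"
  assumes pos: "\<And>x. x \<noteq> 0 \<Longrightarrow> 0 < x \<bullet> (A *v x)"
  shows integrable_complex_gaussian: "integrable lborel (\<lambda>\<phi>. exp (- cpair \<phi> (cmat A *v vcnj \<phi>)))"
    and integral_complex_gaussian:
      "(\<integral>\<phi>. exp (- cpair \<phi> (cmat A *v vcnj \<phi>)) \<partial>lborel) = complex_of_real (pi ^ CARD('n) / det A)"
proof -
  have T: "complex_vec \<in> lborel \<Otimes>\<^sub>M lborel \<rightarrow>\<^sub>M borel" by (simp add: lborel_prod)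
  have m: "(\<lambda>\<phi>::complex ^ 'n. exp (- cpair \<phi> (cmat A *v vcnj \<phi>))) \<in> borel_measurable borel"
    unfolding cpair_def matrix_vector_mult_def vcnj_def
    by (intro borel_measurable_continuous_onI continuous_intros)
  show "integrable lborel (\<lambda>\<phi>. exp (- cpair \<phi> (cmat A *v vcnj \<phi>)))"
    unfolding lborel_complex_vec integrable_distr_eq[OF T m] by (rule integrable_gaussian_pair[OF pos])
  show "(\<integral>\<phi>. exp (- cpair \<phi> (cmat A *v vcnj \<phi>)) \<partial>lborel) = complex_of_real (pi ^ CARD('n) / det A)"
    unfolding lborel_complex_vec integral_distr[OF T m] by (rule integral_gaussian_pair[OF pos])
qed

subsection \<open>Uniqueness of Laplace transforms\<close>

text \<open>Polynomials in expanded form. The property to be proved of them later,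
  \<open>matching\<close>, is additive but not multiplicative, so an induction with a case for
  products, as for \<open>real_polynomial_function\<close>, would fail.\<close>

inductive monomial_span :: "(real ^ 'n \<Rightarrow> real) \<Rightarrow> bool" where
  monomial: "monomial_span (\<lambda>y. c * (\<Prod>i\<in>UNIV. (y $ i) ^ (a i)))"
| add: "monomial_span g \<Longrightarrow> monomial_span h \<Longrightarrow> monomial_span (\<lambda>y. g y + h y)"

lemma monomial_span_zero: "monomial_span (\<lambda>_. 0)"
  using monomial_span.monomial[of 0] by simp

lemma monomial_span_one: "monomial_span (\<lambda>_. 1)"
  using monomial_span.monomial[of 1 "\<lambda>_. 0"] by simp

lemma monomial_span_cmult:
  assumes "monomial_span h"
  shows "monomial_span (\<lambda>y. c * h y)"
  using assms
proof induction
  case (monomial d a)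
  show ?case using monomial_span.monomial[of "c * d" a] by (simp add: mult.assoc)
qed (simp add: distrib_left monomial_span.add)

lemma monomial_span_sum:
  assumes "finite I" "\<And>i. i \<in> I \<Longrightarrow> monomial_span (h i)"
  shows "monomial_span (\<lambda>y. \<Sum>i\<in>I. h i y)"
  using assms by (induction I rule: finite_induct) (auto intro: monomial_span_zero monomial_span.add)

lemma monomial_span_mult_coordinate:
  fixes h :: "real ^ 'n \<Rightarrow> real"
  assumes "monomial_span h"
  shows "monomial_span (\<lambda>y. y $ k * h y)"
  using assms
proof induction
  case (monomial c a)
  have "(\<Prod>i\<in>UNIV. (y $ i) ^ ((a(k := Suc (a k))) i)) = y $ k * (\<Prod>i\<in>UNIV. (y $ i) ^ a i)" for y :: "real ^ 'n"
    by (subst (1 2) prod.remove[of UNIV k]) auto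
  then show ?case
    using monomial_span.monomial[of c "a(k := Suc (a k))"] by (simp add: mult.left_commute)
qed (simp add: distrib_left monomial_span.add)

text \<open>The factor \<open>h\<close> is arbitrary so that the product case is two successive
  multiplications, first by \<open>q\<close> and then by \<open>p\<close>. A linear function is
  expanded in coordinates.\<close>

lemma monomial_span_mult_real_polynomial:
  fixes p :: "real ^ 'n \<Rightarrow> real"
  assumes "real_polynomial_function p" "monomial_span h"
  shows "monomial_span (\<lambda>y. p y * h y)"
  using assms
proof (induction arbitrary: h rule: real_polynomial_function.induct)
  case (linear p)
  have p: "p y = (\<Sum>i\<in>UNIV. p (axis i 1) * y $ i)" for y
  proof -
    have "y = (\<Sum>i\<in>UNIV. (y $ i) *\<^sub>R axis i 1)"
      by (simp add: vec_eq_iff axis_def if_distrib cong: if_cong)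
    then have "p y = p (\<Sum>i\<in>UNIV. (y $ i) *\<^sub>R axis i 1)" by simp
    also have "\<dots> = (\<Sum>i\<in>UNIV. p (axis i 1) * y $ i)"
      using bounded_linear.linear[OF linear.hyps] by (simp add: linear_sum linear_cmul mult.commute)
    finally show ?thesis .
  qed
  have "p y * h y = (\<Sum>i\<in>UNIV. p (axis i 1) * (y $ i * h y))" for y
    unfolding sum_distrib_right[symmetric] mult.assoc[symmetric] by (subst p) simp
  then show ?case
    using linear.prems by (auto intro!: monomial_span_sum monomial_span_cmult monomial_span_mult_coordinate)
next
  case (const c)
  then show ?case by (rule monomial_span_cmult)
next
  case (add p q)
  then show ?case by (simp add: distrib_right monomial_span.add)
next
  case (mult p q)
  then show ?case by (simp add: mult.assoc)
qed

lemma real_polynomial_monomial_span: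
  "real_polynomial_function p \<Longrightarrow> monomial_span p"
  using monomial_span_mult_real_polynomial[OF _ monomial_span_one] by simp

text \<open>The image under \<open>T\<close> of the complex measure with density \<open>D\<close> is
  compared with the law of \<open>L\<close>, a finite positive measure. Leaving \<open>P\<close>,
  \<open>T\<close> and \<open>D\<close> abstract covers both the single Gaussian and the product of
  k copies.\<close>

context
  fixes P :: "'p measure" and T :: "'p \<Rightarrow> real ^ 'n" and D :: "'p \<Rightarrow> complex"
    and N :: "'b measure" and L :: "'b \<Rightarrow> real ^ 'n"
  assumes fN: "finite_measure N"
    and iD: "integrable P D"
    and mT [measurable]: "T \<in> borel_measurable P" and T_nonneg: "\<And>p. p \<in> space P \<Longrightarrow> T p \<in> nonneg_orthant"
    and mL [measurable]: "L \<in> borel_measurable N" and L_nonneg: "\<And>\<omega>. \<omega> \<in> space N \<Longrightarrow> L \<omega> \<in> nonneg_orthant"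
    and laplace: "\<And>v. v \<in> nonneg_orthant \<Longrightarrow>
      (\<integral>p. complex_of_real (exp (- (v \<bullet> T p))) * D p \<partial>P) = complex_of_real (\<integral>\<omega>. exp (- (v \<bullet> L \<omega>)) \<partial>N)"
begin

interpretation N: finite_measure N by (rule fN)

private lemma mD [measurable]: "D \<in> borel_measurable P"
  using iD by auto

text \<open>Integrability is included because the Bochner integral of a non-integrable function is
  0; the bare equation would not be stable under sums and limits.\<close>

private definition matching :: "(real ^ 'n \<Rightarrow> real) \<Rightarrow> bool" where
  "matching g \<longleftrightarrow> integrable P (\<lambda>p. complex_of_real (g (T p)) * D p) \<and> integrable N (\<lambda>\<omega>. g (L \<omega>)) \<and>
     (\<integral>p. complex_of_real (g (T p)) * D p \<partial>P) = complex_of_real (\<integral>\<omega>. g (L \<omega>) \<partial>N)"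

private lemma integrable_bounded:
  assumes [measurable]: "g \<in> borel_measurable borel" and b: "\<And>x. x \<in> nonneg_orthant \<Longrightarrow> \<bar>g x\<bar> \<le> b"
  shows "integrable P (\<lambda>p. complex_of_real (g (T p)) * D p)" "integrable N (\<lambda>\<omega>. g (L \<omega>))"
proof -
  show "integrable N (\<lambda>\<omega>. g (L \<omega>))"
    by (rule N.integrable_const_bound[of _ b]) (auto intro!: b L_nonneg)
  show "integrable P (\<lambda>p. complex_of_real (g (T p)) * D p)"
  proof (rule Bochner_Integration.integrable_bound[of P "\<lambda>p. b * cmod (D p)"])
    show "AE p in P. cmod (complex_of_real (g (T p)) * D p) \<le> norm (b * cmod (D p))"
    proof (rule AE_I2)
      fix p assume "p \<in> space P"
      then have "\<bar>g (T p)\<bar> * cmod (D p) \<le> b * cmod (D p)"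
        by (intro mult_right_mono b T_nonneg) auto
      then show "cmod (complex_of_real (g (T p)) * D p) \<le> norm (b * cmod (D p))"
        by (simp add: norm_mult)
    qed
  qed (use iD in auto)
qed

private lemma matching_add:
  "matching g \<Longrightarrow> matching h \<Longrightarrow> matching (\<lambda>x. g x + h x)"
  by (simp add: matching_def distrib_right)

text \<open>Dominated convergence on both sides at once: the single bound \<open>b\<close> has to be
  integrable against the modulus of \<open>D\<close> and under the law of \<open>L\<close>. Bound
  and convergence are asked for on the orthant, where \<open>T\<close> and \<open>L\<close> take
  their values.\<close>

private lemma matching_lim:
  assumes s: "\<And>i. matching (s i)"
    and [measurable]: "g \<in> borel_measurable borel"
    and bP: "integrable P (\<lambda>p. b (T p) * cmod (D p))" and bN: "integrable N (\<lambda>\<omega>. b (L \<omega>))"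
    and sb: "\<And>i x. x \<in> nonneg_orthant \<Longrightarrow> \<bar>s i x\<bar> \<le> b x"
    and lim: "\<And>x. x \<in> nonneg_orthant \<Longrightarrow> (\<lambda>i. s i x) \<longlonglongrightarrow> g x"
  shows "matching g"
proof -
  have msP: "(\<lambda>p. complex_of_real (s i (T p)) * D p) \<in> borel_measurable P" for i
    using s[of i] by (auto simp: matching_def)
  have msN: "(\<lambda>\<omega>. s i (L \<omega>)) \<in> borel_measurable N" for i
    using s[of i] by (auto simp: matching_def)
  have aP1: "AE p in P. (\<lambda>i. complex_of_real (s i (T p)) * D p) \<longlonglongrightarrow> complex_of_real (g (T p)) * D p"
    by (intro AE_I2 tendsto_intros lim T_nonneg)
  have aP2: "AE p in P. norm (complex_of_real (s i (T p)) * D p) \<le> b (T p) * cmod (D p)" for i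
    by (intro AE_I2) (auto simp: norm_mult intro!: mult_right_mono sb T_nonneg)
  have aN1: "AE \<omega> in N. (\<lambda>i. s i (L \<omega>)) \<longlonglongrightarrow> g (L \<omega>)"
    by (intro AE_I2 lim L_nonneg)
  have aN2: "AE \<omega> in N. norm (s i (L \<omega>)) \<le> b (L \<omega>)" for i
    by (intro AE_I2) (auto intro!: sb L_nonneg)
  have mgP: "(\<lambda>p. complex_of_real (g (T p)) * D p) \<in> borel_measurable P" by measurable
  have mgN: "(\<lambda>\<omega>. g (L \<omega>)) \<in> borel_measurable N" by measurable
  note domP = integrable_dominated_convergence[OF mgP msP bP aP1 aP2] integral_dominated_convergence[OF mgP msP bP aP1 aP2]
  note domN = integrable_dominated_convergence[OF mgN msN bN aN1 aN2] integral_dominated_convergence[OF mgN msN bN aN1 aN2]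
  have "(\<lambda>i. \<integral>p. complex_of_real (s i (T p)) * D p \<partial>P) = (\<lambda>i. complex_of_real (\<integral>\<omega>. s i (L \<omega>) \<partial>N))"
    using s by (auto simp: matching_def)
  then have "(\<lambda>i. complex_of_real (\<integral>\<omega>. s i (L \<omega>) \<partial>N)) \<longlonglongrightarrow> (\<integral>p. complex_of_real (g (T p)) * D p \<partial>P)"
    using domP(2) by simp
  moreover have "(\<lambda>i. complex_of_real (\<integral>\<omega>. s i (L \<omega>) \<partial>N)) \<longlonglongrightarrow> complex_of_real (\<integral>\<omega>. g (L \<omega>) \<partial>N)"
    by (intro tendsto_of_real domN(2))
  ultimately show ?thesis
    unfolding matching_def using domP(1) domN(1) LIMSEQ_unique by blast
qed

private lemma matching_lim_bounded:
  assumes s: "\<And>i. matching (s i)"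
    and [measurable]: "g \<in> borel_measurable borel"
    and sb: "\<And>i x. x \<in> nonneg_orthant \<Longrightarrow> \<bar>s i x\<bar> \<le> b"
    and lim: "\<And>x. x \<in> nonneg_orthant \<Longrightarrow> (\<lambda>i. s i x) \<longlonglongrightarrow> g x"
  shows "matching g"
  by (rule matching_lim[where b = "\<lambda>_. b" and s = s]) (use iD s sb lim in auto)

text \<open>This map sends the orthant into the unit cube and turns the Laplace kernels with integer
  parameters into the monomials, so that Stone--Weierstrass applies.\<close>

private definition expn :: "real ^ 'n \<Rightarrow> real ^ 'n" where
  "expn x = (\<chi> i. exp (- x $ i))"

private lemma expn_measurable [measurable]: "expn \<in> borel_measurable borel"
  unfolding expn_def by (intro borel_measurable_continuous_onI continuous_intros)

private lemma expn_in_cube: "x \<in> nonneg_orthant \<Longrightarrow> expn x \<in> cbox 0 1"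
  by (simp add: expn_def mem_box_cart nonneg_orthant_def)

private lemma matching_monomial_span:
  "monomial_span h \<Longrightarrow> matching (\<lambda>x. h (expn x))"
proof (induction rule: monomial_span.induct)
  case (monomial c a)
  let ?v = "(\<chi> i. real (a i)) :: real ^ 'n"
  have e: "(\<Prod>i\<in>UNIV. (expn x $ i) ^ (a i)) = exp (- (?v \<bullet> x))" for x
    by (simp add: expn_def inner_vec_def exp_of_nat_mult[symmetric] exp_sum[symmetric] sum_negf)
  have v: "?v \<in> nonneg_orthant" by (simp add: nonneg_orthant_def)
  have "0 \<le> ?v \<bullet> x" if "x \<in> nonneg_orthant" for x
    using that by (auto simp: inner_vec_def nonneg_orthant_def intro!: sum_nonneg)
  then have i: "integrable P (\<lambda>p. complex_of_real (exp (- (?v \<bullet> T p))) * D p)" "integrable N (\<lambda>\<omega>. exp (- (?v \<bullet> L \<omega>)))"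
    by (intro integrable_bounded[where b = 1 and g = "\<lambda>x. exp (- (?v \<bullet> x))"]; simp)+
  show ?case
    unfolding matching_def e using i laplace[OF v] by (simp add: mult.assoc)
qed (rule matching_add)

private lemma matching_continuous:
  assumes g: "continuous_on UNIV g"
  shows "matching (\<lambda>x. g (expn x))"
proof -
  let ?S = "cbox 0 1 :: (real ^ 'n) set"
  have gS: "continuous_on ?S g" using g continuous_on_subset by blast
  have "\<exists>p. real_polynomial_function p \<and> (\<forall>y\<in>?S. \<bar>g y - p y\<bar> < 1 / real (Suc n))" for n
    using Stone_Weierstrass_real_polynomial_function[OF compact_cbox gS, of "1 / real (Suc n)"]
    by (metis zero_less_divide_1_iff of_nat_0_less_iff zero_less_Suc)
  then obtain p where p: "\<And>n. real_polynomial_function (p n)"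
    "\<And>n y. y \<in> ?S \<Longrightarrow> \<bar>g y - p n y\<bar> < 1 / real (Suc n)" by metis
  have "bounded (g ` ?S)" by (intro compact_imp_bounded compact_continuous_image gS compact_cbox)
  then obtain c where c: "\<And>y. y \<in> ?S \<Longrightarrow> \<bar>g y\<bar> \<le> c" by (auto simp: bounded_iff)
  \<comment> \<open>The bound \<open>c + 1\<close> arises because \<open>c\<close> bounds
    \<open>g\<close> on the cube and every approximant has error below 1 there.\<close>
  show ?thesis
  proof (rule matching_lim_bounded[where s = "\<lambda>n x. p n (expn x)" and b = "c + 1"])
    show "matching (\<lambda>x. p n (expn x))" for n
      by (intro matching_monomial_span real_polynomial_monomial_span p)
    have [measurable]: "g \<in> borel_measurable borel" using g by (rule borel_measurable_continuous_onI)
    show "(\<lambda>x. g (expn x)) \<in> borel_measurable borel" by measurable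
  next
    fix n and x :: "real ^ 'n" assume "x \<in> nonneg_orthant"
    then have "expn x \<in> ?S" by (rule expn_in_cube)
    moreover have "1 / real (Suc n) \<le> 1" by simp
    ultimately show "\<bar>p n (expn x)\<bar> \<le> c + 1"
      using p(2)[of "expn x" n] c[of "expn x"] by linarith
  next
    fix x :: "real ^ 'n" assume "x \<in> nonneg_orthant"
    then have x: "expn x \<in> ?S" by (rule expn_in_cube)
    show "(\<lambda>n. p n (expn x)) \<longlonglongrightarrow> g (expn x)"
    proof (rule LIM_zero_cancel, rule Lim_null_comparison)
      show "\<forall>\<^sub>F n in sequentially. norm (p n (expn x) - g (expn x)) \<le> 1 / real (Suc n)"
        by (intro always_eventually allI) (metis p(2)[OF x] abs_minus_commute less_imp_le real_norm_def)
      show "(\<lambda>n. 1 / real (Suc n)) \<longlonglongrightarrow> 0" by (rule LIMSEQ_Suc[OF lim_1_over_n])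
    qed
  qed
qed

text \<open>The truncated functions 1 - n dist(y, S) are continuous, equal 1 on \<open>S\<close> and
  tend to 0 off the closed set. The empty set is treated apart because \<open>infdist\<close> to it
  is 0, which would make every approximant 1.\<close>

private lemma matching_closed:
  assumes S: "closed S"
  shows "matching (\<lambda>x. indicator S (expn x))"
proof (cases "S = {}")
  case True
  then show ?thesis by (simp add: matching_def)
next
  case False
  show ?thesis
  proof (rule matching_lim_bounded[where s = "\<lambda>n x. max 0 (1 - real n * infdist (expn x) S)" and b = 1])
    show "matching (\<lambda>x. max 0 (1 - real n * infdist (expn x) S))" for n
      by (rule matching_continuous[where g = "\<lambda>y. max 0 (1 - real n * infdist y S)"]) (intro continuous_intros)
    have [measurable]: "S \<in> sets borel" using S by simp
    show "(\<lambda>x. indicator S (expn x)) \<in> borel_measurable borel" by measurable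
    show "\<bar>max 0 (1 - real n * infdist (expn x) S)\<bar> \<le> 1" for n x
      by (simp add: infdist_nonneg)
  next
    fix x :: "real ^ 'n"
    show "(\<lambda>n. max 0 (1 - real n * infdist (expn x) S)) \<longlonglongrightarrow> indicator S (expn x)"
    proof (cases "expn x \<in> S")
      case True
      then show ?thesis by simp
    next
      case False
      then have d: "0 < infdist (expn x) S"
        using S \<open>S \<noteq> {}\<close> in_closed_iff_infdist_zero[of S "expn x"] infdist_nonneg[of "expn x" S] by linarith
      obtain m where m: "1 / infdist (expn x) S < real m" using reals_Archimedean2 by blast
      have "max 0 (1 - real n * infdist (expn x) S) = 0" if "n \<ge> m" for n
      proof -
        have "1 / infdist (expn x) S \<le> real n" using m that by linarith
        then show ?thesis using d by (simp add: field_simps)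
      qed
      then show ?thesis
        using False by (intro tendsto_eventually) (auto simp: eventually_sequentially)
    qed
  qed
qed

text \<open>Dynkin's argument: closed sets form an intersection-stable generator, complements follow
  by linearity, and disjoint unions by bounded convergence of the partial unions.\<close>

private lemma matching_borel:
  assumes "B \<in> sets borel"
  shows "matching (\<lambda>x. indicator B (expn x))"
proof -
  have gen: "B \<in> sigma_sets UNIV (Collect closed)"
    using assms by (simp add: borel_eq_closed)
  have borel: "A \<in> sets borel" if "A \<in> sigma_sets UNIV (Collect closed)" for A :: "(real ^ 'n) set"
    using that by (simp add: borel_eq_closed)
  have "Int_stable (Collect closed :: (real ^ 'n) set set)" by (auto simp: Int_stable_def)
  moreover have "Collect closed \<subseteq> Pow (UNIV :: (real ^ 'n) set)" by simp
  ultimately show ?thesis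
    using gen
  proof (induction rule: sigma_sets_induct_disjoint)
    case (basic A)
    then show ?case by (intro matching_closed) simp
  next
    case empty
    then show ?case by (simp add: matching_def)
  next
    case (compl A)
    have "matching (\<lambda>x. indicator UNIV (expn x))" by (rule matching_closed) simp
    then have "matching (\<lambda>x. indicator UNIV (expn x) - indicator A (expn x))"
      using compl.IH by (simp add: matching_def left_diff_distrib)
    also have "(\<lambda>x. indicator UNIV (expn x) - indicator A (expn x)) = (\<lambda>x. indicator (UNIV - A) (expn x) :: real)"
      by (auto simp: indicator_def)
    finally show ?case .
  next
    case (union A)
    have [measurable]: "A i \<in> sets borel" for i
      by (rule borel) (use union.hyps(2) in blast)
    then have [measurable]: "\<Union> (range A) \<in> sets borel" by blast
    show ?case
    proof (rule matching_lim_bounded[where s = "\<lambda>n x. indicator (\<Union>i<n. A i) (expn x)" and b = 1])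
      fix n
      show "matching (\<lambda>x. indicator (\<Union>i<n. A i) (expn x))"
      proof (induction n)
        case 0
        then show ?case by (simp add: matching_def)
      next
        case (Suc n)
        have "A n \<inter> (\<Union>i<n. A i) = {}"
          using disjoint_family_onD[OF union.hyps(1), of n] by (auto simp: set_eq_iff)
        then have eq: "(\<lambda>x. indicator (\<Union>i<n. A i) (expn x) + indicator (A n) (expn x))
           = (\<lambda>x. indicator (\<Union>i<Suc n. A i) (expn x) :: real)"
          by (auto simp: fun_eq_iff indicator_def less_Suc_eq)
        show ?case using matching_add[OF Suc union.IH[of n]] unfolding eq .
      qed
    next
      show "(\<lambda>x. indicator (\<Union> (range A)) (expn x)) \<in> borel_measurable borel" by measurable
      show "(\<lambda>n. indicator (\<Union>i<n. A i) (expn x) :: real) \<longlonglongrightarrow> indicator (\<Union> (range A)) (expn x)" for x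
        by (rule LIMSEQ_indicator_UN)
      show "\<bar>indicator (\<Union>i<n. A i) (expn x)\<bar> \<le> (1 :: real)" for n x
        by (cases "expn x \<in> (\<Union>i<n. A i)") simp_all
    qed
  qed
qed

text \<open>\<open>?l\<close> is a Borel left inverse of \<open>expn\<close>, so each Borel set is
  the preimage under \<open>expn\<close> of a Borel set.\<close>

private lemma matching_indicator:
  assumes [measurable]: "A \<in> sets borel"
  shows "matching (indicator A)"
proof -
  let ?l = "\<lambda>y :: real ^ 'n. (\<chi> i. - ln (y $ i)) :: real ^ 'n"
  have "?l \<in> borel_measurable borel"
    unfolding borel_measurable_euclidean_space[of ?l] by (auto simp: Basis_vec_def inner_axis)
  then have "?l -` A \<in> sets borel"
    using measurable_sets_borel assms by blast
  then have "matching (\<lambda>x. indicator (?l -` A) (expn x))" by (rule matching_borel)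
  moreover have "?l (expn x) = x" for x by (simp add: expn_def vec_eq_iff)
  then have "(\<lambda>x. indicator (?l -` A) (expn x)) = (indicator A :: _ \<Rightarrow> real)"
    by (auto simp: fun_eq_iff indicator_def)
  ultimately show ?thesis by (simp only:)
qed

lemma integral_eq_of_laplace_eq:
  fixes f :: "real ^ 'n \<Rightarrow> real"
  assumes f [measurable]: "f \<in> borel_measurable borel"
    and fi: "integrable P (\<lambda>p. complex_of_real (f (T p)) * D p)"
  shows "integrable N (\<lambda>\<omega>. f (L \<omega>))"
    and "(\<integral>p. complex_of_real (f (T p)) * D p \<partial>P) = complex_of_real (\<integral>\<omega>. f (L \<omega>) \<partial>N)"
proof -
  let ?m = "distr (density P (\<lambda>p. ennreal (cmod (D p)))) borel T"
  have im: "integrable ?m g \<longleftrightarrow> integrable P (\<lambda>p. cmod (D p) *\<^sub>R g (T p))"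
    if [measurable]: "g \<in> borel_measurable borel" for g :: "real ^ 'n \<Rightarrow> real"
    by (simp add: integrable_distr_eq integrable_density)
  txt \<open>Domination by the total variation \<open>?m\<close> is what gives integrability of an unbounded \<open>f\<close>
    under the law of \<open>L\<close>.\<close>
  have le: "distr N borel L \<le> ?m"
  proof (subst le_measure)
    show "\<forall>A\<in>sets (distr N borel L). emeasure (distr N borel L) A \<le> emeasure ?m A"
    proof
      fix A assume "A \<in> sets (distr N borel L)"
      then have A [measurable]: "A \<in> sets borel" by simp
      have mA: "matching (indicator A)" by (rule matching_indicator[OF A])
      have "emeasure (distr N borel L) A = ennreal (\<integral>x. indicator A x \<partial>distr N borel L)"
        using N.finite_measure_distr[OF mL] by (simp add: finite_measure.emeasure_eq_measure)
      also have "(\<integral>x. indicator A x \<partial>distr N borel L) = (\<integral>\<omega>. indicat_real A (L \<omega>) \<partial>N)"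
        by (rule integral_distr[OF mL borel_measurable_indicator[OF A]])
      \<comment> \<open>The integral under \<open>N\<close> is real and nonnegative, hence equal to
        its modulus, which \<open>matching\<close> lets one compute on the side of
        \<open>P\<close>.\<close>
      also have "ennreal \<dots> = ennreal (cmod (\<integral>p. complex_of_real (indicator A (T p)) * D p \<partial>P))"
        using mA by (simp add: matching_def integral_nonneg_AE)
      also have "\<dots> \<le> (\<integral>\<^sup>+p. ennreal (cmod (complex_of_real (indicator A (T p)) * D p)) \<partial>P)"
        using mA by (intro integral_norm_bound_ennreal) (simp add: matching_def)
      also have "\<dots> = (\<integral>\<^sup>+p. ennreal (cmod (D p)) * indicator A (T p) \<partial>P)"
        by (intro nn_integral_cong) (auto simp: indicator_def norm_mult)
      also have "\<dots> = (\<integral>\<^sup>+x. indicator A x \<partial>?m)"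
        by (subst nn_integral_distr) (auto simp: nn_integral_density)
      also have "\<dots> = emeasure ?m A" by simp
      finally show "emeasure (distr N borel L) A \<le> emeasure ?m A" .
    qed
  qed simp
  have iN: "integrable N (\<lambda>\<omega>. g (L \<omega>))" if g: "integrable ?m g" for g :: "real ^ 'n \<Rightarrow> real"
  proof -
    have [measurable]: "g \<in> borel_measurable borel" using borel_measurable_integrable[OF g] by simp
    have "(\<integral>\<^sup>+x. ennreal (norm (g x)) \<partial>distr N borel L) \<le> (\<integral>\<^sup>+x. ennreal (norm (g x)) \<partial>?m)"
      by (rule nn_integral_mono_measure[OF _ le]) simp
    also have "\<dots> < \<infinity>" using g by (simp add: integrable_iff_bounded)
    finally have "integrable (distr N borel L) g" by (simp add: integrable_iff_bounded)
    then show ?thesis by (simp add: integrable_distr_eq)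
  qed
  have "integrable P (\<lambda>p. norm (complex_of_real (f (T p)) * D p))"
    using fi by (rule integrable_norm)
  then have "integrable P (\<lambda>p. cmod (D p) *\<^sub>R f (T p))"
    by (rule Bochner_Integration.integrable_bound) (auto simp: norm_mult abs_mult)
  then have "integrable ?m f" by (simp add: im)
  \<comment> \<open>The induction runs over the functions integrable against \<open>?m\<close>. Its
    limit case supplies the bound \<open>2 * \<bar>g x\<bar>\<close>, which is integrable against
    the modulus of \<open>D\<close> by \<open>im\<close> and under the law of \<open>L\<close> by
    \<open>iN\<close>.\<close>
  then have "matching f"
  proof (induction rule: integrable_induct)
    case (base A c)
    then have "matching (indicator A)" by (intro matching_indicator) simp
    then show ?case by (simp add: matching_def mult.commute[of _ c] mult.assoc)
  next
    case (add g h)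
    then show ?case by (intro matching_add)
  next
    case (lim g s)
    have [measurable]: "g \<in> borel_measurable borel" using borel_measurable_integrable[OF lim.hyps(4)] by simp
    have "integrable P (\<lambda>p. cmod (D p) *\<^sub>R g (T p))"
      using lim.hyps(4) by (simp add: im)
    then have "integrable P (\<lambda>p. 2 * norm (cmod (D p) *\<^sub>R g (T p)))" by auto
    then have "integrable P (\<lambda>p. 2 * \<bar>g (T p)\<bar> * cmod (D p))" by (simp add: abs_mult mult_ac)
    then show ?case
    proof (rule matching_lim[where s = s and b = "\<lambda>x. 2 * \<bar>g x\<bar>", rotated 2])
      show "integrable N (\<lambda>\<omega>. 2 * \<bar>g (L \<omega>)\<bar>)" using iN[OF lim.hyps(4)] by auto
      show "matching (s i)" for i by (rule lim.IH)
      show "\<bar>s i x\<bar> \<le> 2 * \<bar>g x\<bar>" for i x using lim.hyps(3)[of x i] by simp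
      show "(\<lambda>i. s i x) \<longlonglongrightarrow> g x" for x using lim.hyps(2)[of x] by simp
    qed measurable
  qed
  then show "integrable N (\<lambda>\<omega>. f (L \<omega>))"
    and "(\<integral>p. complex_of_real (f (T p)) * D p \<partial>P) = complex_of_real (\<integral>\<omega>. f (L \<omega>) \<partial>N)"
    by (simp_all add: matching_def)
qed

end

subsection \<open>Permanental vectors\<close>

lemma closed_nonneg_orthant: "closed (nonneg_orthant :: (real ^ 'n) set)"
  unfolding nonneg_orthant_def by (intro closed_Collect_all closed_Collect_le continuous_intros)

text \<open>The growth condition controls \<open>f\<close> outside a ball and local boundedness
  controls it inside; in the constant \<open>max 1 c\<close>, the 1 serves the outside and
  \<open>c\<close> the inside.\<close>

lemma subexponential_growth_bound:
  fixes f :: "real ^ 'n \<Rightarrow> real"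
  assumes f: "subexponential_growth f" "locally_bounded f" and e: "0 < e"
  obtains K where "\<And>x. x \<in> nonneg_orthant \<Longrightarrow> \<bar>f x\<bar> \<le> K * exp (e * norm x)"
proof -
  have "\<forall>\<^sub>F x in inf at_infinity (principal nonneg_orthant). ln (1 + \<bar>f x\<bar>) / norm x < e"
    using f(1) e unfolding subexponential_growth_def by (rule order_tendstoD)
  then obtain r where r: "\<And>x. r \<le> norm x \<Longrightarrow> x \<in> nonneg_orthant \<Longrightarrow> ln (1 + \<bar>f x\<bar>) / norm x < e"
    by (auto simp: eventually_inf_principal eventually_at_infinity)
  \<comment> \<open>A radius of at least 1 keeps \<open>norm x\<close> positive outside the ball, so
    that the quotient by the norm can be cleared.\<close>
  let ?B = "cball 0 (max 1 r) \<inter> nonneg_orthant"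
  have "bounded ?B" by (intro bounded_Int) simp
  then have "bounded (f ` ?B)" using f(2) by (auto simp: locally_bounded_def)
  then obtain c where c: "\<And>x. x \<in> ?B \<Longrightarrow> \<bar>f x\<bar> \<le> c" unfolding bounded_iff by fastforce
  have "\<bar>f x\<bar> \<le> max 1 c * exp (e * norm x)" if x: "x \<in> nonneg_orthant" for x
  proof (cases "x \<in> ?B")
    case True
    have "max 1 c * 1 \<le> max 1 c * exp (e * norm x)"
      using e by (intro mult_left_mono) auto
    then show ?thesis using c[OF True] by linarith
  next
    case False
    then have n: "1 < norm x" "r \<le> norm x" using x by auto
    then have "0 < norm x" by linarith
    then have "ln (1 + \<bar>f x\<bar>) \<le> e * norm x"
      using r[OF n(2) x] by (simp add: pos_divide_less_eq)
    then have "exp (ln (1 + \<bar>f x\<bar>)) \<le> exp (e * norm x)" by (simp only: exp_le_cancel_iff)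
    moreover have "exp (ln (1 + \<bar>f x\<bar>)) = 1 + \<bar>f x\<bar>" by (rule exp_ln) simp
    moreover have "1 * exp (e * norm x) \<le> max 1 c * exp (e * norm x)"
      by (intro mult_right_mono) auto
    ultimately show ?thesis by linarith
  qed
  then show ?thesis by (rule that)
qed

text \<open>The common core of both formulas, used with \<alpha> = 1 for one Gaussian and with
  \<alpha> = k for the product. The exponential moment of order \<open>e\<close> absorbs a locally
  bounded \<open>f\<close>, since subexponential growth allows every positive rate.\<close>

lemma permanental_expectation:
  fixes f :: "real ^ 'n \<Rightarrow> real"
  assumes perm: "permanental_vector N \<alpha> G L"
    and f: "f \<in> borel_measurable (restrict_space borel nonneg_orthant)" "subexponential_growth f"
    and D: "integrable P D" and T [measurable]: "T \<in> borel_measurable P"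
    and T_nonneg: "\<And>p. p \<in> space P \<Longrightarrow> T p \<in> nonneg_orthant"
    and laplace: "\<And>v. v \<in> nonneg_orthant \<Longrightarrow>
      (\<integral>p. complex_of_real (exp (- (v \<bullet> T p))) * D p \<partial>P) = complex_of_real (det (mat 1 + diag v ** G) powr (- \<alpha>))"
    and e: "0 < e" and exp_integrable: "integrable P (\<lambda>p. exp (e * norm (T p)) * cmod (D p))"
    and F: "locally_bounded f \<or> integrable P (\<lambda>p. complex_of_real (f (T p)) * D p)"
  shows "integrable N (\<lambda>\<omega>. f (L \<omega>)) \<and> integrable P (\<lambda>p. complex_of_real (f (T p)) * D p) \<and>
    complex_of_real (\<integral>\<omega>. f (L \<omega>) \<partial>N) = (\<integral>p. complex_of_real (f (T p)) * D p \<partial>P)"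
proof -
  have N: "prob_space N" "L \<in> borel_measurable N" "\<And>\<omega>. \<omega> \<in> space N \<Longrightarrow> L \<omega> \<in> nonneg_orthant"
    and NL: "\<And>v. v \<in> nonneg_orthant \<Longrightarrow> (\<integral>\<omega>. exp (- (v \<bullet> L \<omega>)) \<partial>N) = det (mat 1 + diag v ** G) powr (- \<alpha>)"
    using perm by (auto simp: permanental_vector_def)
  \<comment> \<open>\<open>f\<close> is measurable only on the orthant; its extension by zero is
    Borel on the whole space and agrees with \<open>f\<close> along \<open>T\<close> and
    \<open>L\<close>.\<close>
  define g where "g x = indicator nonneg_orthant x *\<^sub>R f x" for x
  have g [measurable]: "g \<in> borel_measurable borel"
    using f(1) borel_measurable_restrict_space_iff[of nonneg_orthant borel f] borel_closed[OF closed_nonneg_orthant]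
    by (simp add: g_def[abs_def])
  have gT: "g (T p) = f (T p)" if "p \<in> space P" for p
    using T_nonneg[OF that] by (simp add: g_def)
  have gL: "g (L \<omega>) = f (L \<omega>)" if "\<omega> \<in> space N" for \<omega>
    using N(3)[OF that] by (simp add: g_def)
  have [measurable]: "D \<in> borel_measurable P" using D by auto
  have "integrable P (\<lambda>p. complex_of_real (g (T p)) * D p)"
    using F
  proof
    assume "locally_bounded f"
    then obtain K where K: "\<And>x. x \<in> nonneg_orthant \<Longrightarrow> \<bar>f x\<bar> \<le> K * exp (e * norm x)"
      using subexponential_growth_bound[OF f(2) _ e] by metis
    show ?thesis
    proof (rule Bochner_Integration.integrable_bound[OF integrable_mult_right[OF exp_integrable, of K]])
      show "AE p in P. norm (complex_of_real (g (T p)) * D p) \<le> norm (K * (exp (e * norm (T p)) * cmod (D p)))"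
      proof (rule AE_I2)
        fix p assume p: "p \<in> space P"
        have "\<bar>f (T p)\<bar> * cmod (D p) \<le> K * exp (e * norm (T p)) * cmod (D p)"
          by (intro mult_right_mono K T_nonneg p) simp
        then show "norm (complex_of_real (g (T p)) * D p) \<le> norm (K * (exp (e * norm (T p)) * cmod (D p)))"
          by (simp add: gT[OF p] norm_mult mult.assoc)
      qed
    qed measurable
  next
    assume "integrable P (\<lambda>p. complex_of_real (f (T p)) * D p)"
    then show ?thesis by (simp add: gT cong: Bochner_Integration.integrable_cong)
  qed
  moreover have "finite_measure N" using N(1) by (simp add: prob_space_def)
  ultimately have "integrable N (\<lambda>\<omega>. g (L \<omega>))" "integrable P (\<lambda>p. complex_of_real (g (T p)) * D p)"
      "(\<integral>p. complex_of_real (g (T p)) * D p \<partial>P) = complex_of_real (\<integral>\<omega>. g (L \<omega>) \<partial>N)"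
    using integral_eq_of_laplace_eq[OF _ D T T_nonneg N(2,3) _ g] by (simp_all add: laplace NL)
  then show ?thesis
    by (simp add: gT gL cong: Bochner_Integration.integrable_cong Bochner_Integration.integral_cong)
qed

section \<open>The Gaussian density attached to \<open>G\<close>\<close>

lemma mult_cnj_nonneg: "mult_cnj \<phi> \<in> nonneg_orthant"
  by (simp add: mult_cnj_def nonneg_orthant_def)

lemma mult_cnj_measurable [measurable]: "mult_cnj \<in> borel_measurable borel"
  unfolding mult_cnj_def by (intro borel_measurable_continuous_onI continuous_intros)

lemma cpair_add_diag:
  "cpair \<phi> (cmat (A + diag v) *v vcnj \<phi>) = cpair \<phi> (cmat A *v vcnj \<phi>) + complex_of_real (v \<bullet> mult_cnj \<phi>)"
proof -
  have "(cmat (A + diag v) *v vcnj \<phi>) $ i = (cmat A *v vcnj \<phi>) $ i + complex_of_real (v $ i) * cnj (\<phi> $ i)" for i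
  proof -
    have "(\<Sum>j\<in>UNIV. complex_of_real (diag v $ i $ j) * cnj (\<phi> $ j))
      = (\<Sum>j\<in>UNIV. if i = j then complex_of_real (v $ i) * cnj (\<phi> $ j) else 0)"
      by (intro sum.cong) (auto simp: diag_def)
    then show ?thesis
      by (simp add: matrix_vector_mult_def cmat_def vcnj_def distrib_right sum.distrib)
  qed
  moreover have "\<phi> $ i * (complex_of_real (v $ i) * cnj (\<phi> $ i)) = complex_of_real (v $ i * mult_cnj \<phi> $ i)" for i
    by (simp add: mult_cnj_def complex_eq_iff algebra_simps)
  then have "(\<Sum>i\<in>UNIV. \<phi> $ i * (complex_of_real (v $ i) * cnj (\<phi> $ i))) = complex_of_real (v \<bullet> mult_cnj \<phi>)"
    unfolding inner_vec_def of_real_sum inner_real_def by (intro sum.cong) simp_all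
  ultimately show ?thesis
    by (simp add: cpair_def distrib_left sum.distrib)
qed

lemma cpair_uminus: "cpair \<phi> (cmat (- A) *v \<psi>) = - cpair \<phi> (cmat A *v \<psi>)"
  by (simp add: cpair_def matrix_vector_mult_def cmat_def sum_negf)

text \<open>A matrix and its transpose have the same quadratic form, so the form of \<open>G\<close>
  is that of its symmetric part.\<close>

lemma definite_of_symmetric_part:
  assumes "positive_definite (symmetric_part G)" "x \<noteq> 0"
  shows "0 < x \<bullet> (G *v x)"
proof -
  have "x \<bullet> (transpose G *v x) = x \<bullet> (G *v x)"
    using dot_lmul_matrix[of x G x] by (simp add: inner_commute)
  then have "x \<bullet> (symmetric_part G *v x) = x \<bullet> (G *v x)"
    by (simp add: symmetric_part_def scaleR_matrix_vector_assoc[symmetric] matrix_vector_mult_add_rdistrib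
        inner_add_right del: transpose_matrix_vector)
  then show ?thesis using assms unfolding positive_definite_def by metis
qed

lemma inner_diag_mult_nonneg:
  assumes "v \<in> nonneg_orthant"
  shows "0 \<le> x \<bullet> (diag v *v x)"
proof -
  have "(diag v *v x) $ i = v $ i * x $ i" for i
  proof -
    have "(\<Sum>j\<in>UNIV. diag v $ i $ j * x $ j) = (\<Sum>j\<in>UNIV. if i = j then v $ i * x $ j else 0)"
      by (intro sum.cong) (auto simp: diag_def)
    then show ?thesis by (simp add: matrix_vector_mult_def)
  qed
  then have "x \<bullet> (diag v *v x) = (\<Sum>i\<in>UNIV. v $ i * (x $ i)\<^sup>2)"
    by (simp add: inner_vec_def power2_eq_square mult_ac)
  then show ?thesis
    using assms by (auto simp: nonneg_orthant_def intro!: sum_nonneg)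
qed

lemma det_mat_1_add_diag_mult:
  fixes G :: "real ^ 'n ^ 'n"
  assumes "det G \<noteq> 0"
  shows "det (mat 1 + diag v ** G) = det (matrix_inv G + diag v) * det G"
proof -
  have "(matrix_inv G + diag v) ** G = matrix_inv G ** G + diag v ** G"
    by (simp add: vec_eq_iff matrix_matrix_mult_def distrib_right sum.distrib)
  then have "mat 1 + diag v ** G = (matrix_inv G + diag v) ** G"
    using assms by (simp add: matrix_inv_matrix_mul)
  then show ?thesis by (simp add: det_mul)
qed

lemma gaussian_density:
  fixes G :: "real ^ 'n ^ 'n"
  assumes G: "\<And>x. x \<noteq> 0 \<Longrightarrow> 0 < x \<bullet> (G *v x)"
    and v: "\<And>x. x \<noteq> 0 \<Longrightarrow> 0 < x \<bullet> ((matrix_inv G + diag v) *v x)"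
  defines "h \<equiv> \<lambda>\<phi>. complex_of_real (exp (- (v \<bullet> mult_cnj \<phi>)))
      * (complex_of_real (1 / (pi ^ CARD('n) * det G)) * exp (cpair \<phi> (cmat (- matrix_inv G) *v vcnj \<phi>)))"
  shows integrable_gaussian_density: "integrable lborel h"
    and integral_gaussian_density: "(\<integral>\<phi>. h \<phi> \<partial>lborel) = complex_of_real (inverse (det (mat 1 + diag v ** G)))"
proof -
  have dG: "0 < det G" by (rule det_pos_if_definite[OF G])
  have h: "h = (\<lambda>\<phi>. complex_of_real (1 / (pi ^ CARD('n) * det G))
      * exp (- cpair \<phi> (cmat (matrix_inv G + diag v) *v vcnj \<phi>)))"
    unfolding h_def cpair_add_diag cpair_uminus
    by (simp add: fun_eq_iff exp_of_real[symmetric] exp_diff exp_minus field_simps)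
  show "integrable lborel h"
    unfolding h by (intro integrable_mult_right integrable_complex_gaussian v)
  have "det (mat 1 + diag v ** G) = det (matrix_inv G + diag v) * det G"
    using dG by (intro det_mat_1_add_diag_mult) simp
  moreover have "(\<integral>\<phi>. h \<phi> \<partial>lborel) = complex_of_real (1 / (pi ^ CARD('n) * det G))
      * complex_of_real (pi ^ CARD('n) / det (matrix_inv G + diag v))"
    unfolding h by (subst integral_mult_right_zero) (simp add: integral_complex_gaussian[OF v])
  ultimately show "(\<integral>\<phi>. h \<phi> \<partial>lborel) = complex_of_real (inverse (det (mat 1 + diag v ** G)))"
    by (simp add: field_simps)
qed

text \<open>The l1 norm dominates the Euclidean norm and is linear on the orthant, so an exponential
  moment is bounded by a Laplace kernel with the constant parameter -e.\<close>

lemma exp_norm_le_exp_inner: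
  assumes x: "x \<in> nonneg_orthant" and e: "0 \<le> e"
  shows "exp (e * norm x) \<le> exp (- ((\<chi> i. - e) \<bullet> x))"
proof -
  have "norm x \<le> (\<Sum>i\<in>UNIV. \<bar>x $ i\<bar>)" by (rule norm_le_l1_cart)
  also have "\<dots> = (\<Sum>i\<in>UNIV. x $ i)" using x by (simp add: nonneg_orthant_def)
  finally have "e * norm x \<le> e * (\<Sum>i\<in>UNIV. x $ i)" using e by (rule mult_left_mono)
  also have "\<dots> = - ((\<chi> i. - e) \<bullet> x)" by (simp add: inner_vec_def sum_distrib_left sum_negf)
  finally show ?thesis by simp
qed

lemma sum_nonneg_orthant:
  "(\<And>i. i \<in> I \<Longrightarrow> x i \<in> nonneg_orthant) \<Longrightarrow> sum x I \<in> nonneg_orthant"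
  by (auto simp: nonneg_orthant_def sum_nonneg)

theorem theorem3p1:
  fixes G Q :: "real ^ 'n ^ 'n"
    and M :: "'a measure" and l :: "'a \<Rightarrow> real ^ 'n"
    and f :: "real ^ 'n \<Rightarrow> real"
  assumes "positive_definite (symmetric_part G)"
    and "Q = - matrix_inv G"
    and "permanental_vector M 1 G l"
    and "f \<in> borel_measurable (restrict_space borel nonneg_orthant)"
    and "subexponential_growth f"
  shows
    "(let F = (\<lambda>\<phi> :: complex ^ 'n.
           complex_of_real (1 / (pi ^ CARD('n) * det G) * f (mult_cnj \<phi>))
             * exp (cpair \<phi> (cmat Q *v vcnj \<phi>)))
     in locally_bounded f \<or> integrable lborel F \<longrightarrow>
          integrable M (\<lambda>\<omega>. f (l \<omega>)) \<and> integrable lborel F \<and>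
          complex_of_real (\<integral>\<omega>. f (l \<omega>) \<partial>M) = (\<integral>\<phi>. F \<phi> \<partial>lborel)) \<and>
    (\<forall>k\<ge>1. \<forall>(N :: 'b measure) lk. permanental_vector N (real k) G lk \<longrightarrow>
      (let P = (\<Pi>\<^sub>M j\<in>{1..k}. (lborel :: (complex ^ 'n) measure));
           F = (\<lambda>\<phi> :: nat \<Rightarrow> complex ^ 'n.
             complex_of_real (1 / (pi ^ (CARD('n) * k) * det G ^ k)
                 * f (\<Sum>j = 1..k. mult_cnj (\<phi> j)))
               * exp (\<Sum>j = 1..k. cpair (\<phi> j) (cmat Q *v vcnj (\<phi> j))))
       in locally_bounded f \<or> integrable P F \<longrightarrow>
            integrable N (\<lambda>\<omega>. f (lk \<omega>)) \<and> integrable P F \<and>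
            complex_of_real (\<integral>\<omega>. f (lk \<omega>) \<partial>N) = (\<integral>\<phi>. F \<phi> \<partial>P)))"
proof -
  have G: "0 < x \<bullet> (G *v x)" if "x \<noteq> 0" for x
    using definite_of_symmetric_part[OF assms(1) that] .
  have dG: "0 < det G" by (rule det_pos_if_definite[OF G])
  \<comment> \<open>With y the image of x under the inverse of \<open>G\<close>, the form of the
    inverse at x equals the form of \<open>G\<close> at y.\<close>
  have Ginv: "0 < x \<bullet> (matrix_inv G *v x)" if "x \<noteq> 0" for x
  proof -
    have x: "x = G *v (matrix_inv G *v x)"
      using dG by (simp add: matrix_vector_mul_assoc matrix_mul_matrix_inv)
    then have "matrix_inv G *v x \<noteq> 0" using that by auto
    from G[OF this] show ?thesis using x by (simp add: inner_commute)
  qed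
  have Gv: "0 < x \<bullet> ((matrix_inv G + diag v) *v x)" if "v \<in> nonneg_orthant" "x \<noteq> 0" for v x
    using Ginv[OF that(2)] inner_diag_mult_nonneg[OF that(1), of x]
    by (simp add: matrix_vector_mult_add_rdistrib inner_add_right)
  obtain e where e: "0 < e" "\<And>x. x \<noteq> 0 \<Longrightarrow> 0 < x \<bullet> ((matrix_inv G - e *\<^sub>R mat 1) *v x)"
    using definite_coercive[OF Ginv] by metis
  \<comment> \<open>This parameter lies outside the orthant, so it enters only on the Gaussian side,
    where the choice of \<open>e\<close> keeps the shifted matrix definite.\<close>
  define w :: "real ^ 'n" where "w = (\<chi> i. - e)"
  have "matrix_inv G - e *\<^sub>R mat 1 = matrix_inv G + diag w"
    by (simp add: vec_eq_iff diag_def w_def mat_def)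
  with e(2) have Gw: "0 < x \<bullet> ((matrix_inv G + diag w) *v x)" if "x \<noteq> 0" for x
    using that by simp
  let ?c = "complex_of_real (1 / (pi ^ CARD('n) * det G))"
  define D where "D \<phi> = ?c * exp (cpair \<phi> (cmat Q *v vcnj \<phi>))" for \<phi>
  have hv: "integrable lborel (\<lambda>\<phi>. complex_of_real (exp (- (v \<bullet> mult_cnj \<phi>))) * D \<phi>)"
    "(\<integral>\<phi>. complex_of_real (exp (- (v \<bullet> mult_cnj \<phi>))) * D \<phi> \<partial>lborel) = complex_of_real (inverse (det (mat 1 + diag v ** G)))"
    if "v \<in> nonneg_orthant" for v
    using integrable_gaussian_density[OF G Gv[OF that]] integral_gaussian_density[OF G Gv[OF that]]
    unfolding D_def assms(2) by auto
  have hw: "integrable lborel (\<lambda>\<phi>. complex_of_real (exp (- (w \<bullet> mult_cnj \<phi>))) * D \<phi>)"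
    using integrable_gaussian_density[OF G Gw] unfolding D_def assms(2) .
  have D: "integrable lborel D"
    using hv(1)[of 0] by (simp add: nonneg_orthant_def)
  \<comment> \<open>On a positive base, \<open>powr\<close> with exponent -1 or -k is a power of the
    inverse, the form in which the Gaussian integrals arrive.\<close>
  have det_pos: "0 < det (mat 1 + diag v ** G)" if "v \<in> nonneg_orthant" for v
    using dG det_pos_if_definite[OF Gv[OF that]] by (simp add: det_mat_1_add_diag_mult)
  have exp_le: "exp (e * norm x) \<le> exp (- (w \<bullet> x))" if "x \<in> nonneg_orthant" for x
    unfolding w_def using that e(1) by (intro exp_norm_le_exp_inner) auto
  have one: "locally_bounded f \<or> integrable lborel (\<lambda>\<phi>. complex_of_real (f (mult_cnj \<phi>)) * D \<phi>) \<longrightarrow>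
      integrable M (\<lambda>\<omega>. f (l \<omega>)) \<and> integrable lborel (\<lambda>\<phi>. complex_of_real (f (mult_cnj \<phi>)) * D \<phi>) \<and>
      complex_of_real (\<integral>\<omega>. f (l \<omega>) \<partial>M) = (\<integral>\<phi>. complex_of_real (f (mult_cnj \<phi>)) * D \<phi> \<partial>lborel)"
  proof (intro impI permanental_expectation[OF assms(3-5) D _ mult_cnj_nonneg _ e(1)])
    show "(\<integral>\<phi>. complex_of_real (exp (- (v \<bullet> mult_cnj \<phi>))) * D \<phi> \<partial>lborel)
        = complex_of_real (det (mat 1 + diag v ** G) powr (- 1))" if "v \<in> nonneg_orthant" for v
      using det_pos[OF that] by (simp add: hv(2)[OF that] powr_minus)
    show "integrable lborel (\<lambda>\<phi>. exp (e * norm (mult_cnj \<phi>)) * cmod (D \<phi>))"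
    proof (rule Bochner_Integration.integrable_bound[OF hw])
      show "AE \<phi> in lborel. norm (exp (e * norm (mult_cnj \<phi>)) * cmod (D \<phi>))
          \<le> norm (complex_of_real (exp (- (w \<bullet> mult_cnj \<phi>))) * D \<phi>)"
        by (intro AE_I2) (simp add: norm_mult, intro mult_right_mono exp_le mult_cnj_nonneg norm_ge_zero)
      show "(\<lambda>\<phi>. exp (e * norm (mult_cnj \<phi>)) * cmod (D \<phi>)) \<in> borel_measurable lborel"
        using borel_measurable_integrable[OF D] by simp
    qed
  qed auto
  have many: "locally_bounded f \<or> integrable P F \<longrightarrow>
      integrable N (\<lambda>\<omega>. f (lk \<omega>)) \<and> integrable P F \<and> complex_of_real (\<integral>\<omega>. f (lk \<omega>) \<partial>N) = (\<integral>\<phi>. F \<phi> \<partial>P)"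
    if perm: "permanental_vector N (real k) G lk"
      and P: "P = (\<Pi>\<^sub>M j\<in>{1..k}. (lborel :: (complex ^ 'n) measure))"
      and F: "F = (\<lambda>\<phi>. complex_of_real (f (\<Sum>j = 1..k. mult_cnj (\<phi> j))) * (\<Prod>j = 1..k. D (\<phi> j)))"
    for k P F and N :: "'b measure" and lk
  proof -
    interpret product_sigma_finite "\<lambda>_::nat. lborel :: (complex ^ 'n) measure" ..
    let ?T = "\<lambda>\<phi> :: nat \<Rightarrow> complex ^ 'n. \<Sum>j = 1..k. mult_cnj (\<phi> j)"
    have prod: "complex_of_real (exp (- (v \<bullet> ?T \<phi>))) * (\<Prod>j = 1..k. D (\<phi> j))
        = (\<Prod>j = 1..k. complex_of_real (exp (- (v \<bullet> mult_cnj (\<phi> j)))) * D (\<phi> j))" for v \<phi>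
      by (simp add: inner_sum_right exp_sum sum_negf[symmetric] prod.distrib)
    have T: "?T \<in> borel_measurable P" unfolding P by measurable
    have DP: "integrable P (\<lambda>\<phi>. \<Prod>j = 1..k. D (\<phi> j))"
      unfolding P by (intro product_integrable_prod D) simp
    have lap: "(\<integral>\<phi>. complex_of_real (exp (- (v \<bullet> ?T \<phi>))) * (\<Prod>j = 1..k. D (\<phi> j)) \<partial>P)
        = complex_of_real (det (mat 1 + diag v ** G) powr (- real k))" if "v \<in> nonneg_orthant" for v
      unfolding prod P using det_pos[OF that]
      by (subst product_integral_prod)
         (simp_all add: hv[OF that] powr_minus powr_realpow power_inverse)
    \<comment> \<open>\<open>exp_le\<close> is applied to the whole sum \<open>?T \<phi>\<close>,
      which lies in the orthant; the resulting kernel at \<open>w\<close> splits into one integrable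
      factor per copy.\<close>
    have expi: "integrable P (\<lambda>\<phi>. exp (e * norm (?T \<phi>)) * cmod (\<Prod>j = 1..k. D (\<phi> j)))"
    proof (rule Bochner_Integration.integrable_bound)
      show "integrable P (\<lambda>\<phi>. \<Prod>j = 1..k. complex_of_real (exp (- (w \<bullet> mult_cnj (\<phi> j)))) * D (\<phi> j))"
        unfolding P by (intro product_integrable_prod hw) simp
      show "AE \<phi> in P. norm (exp (e * norm (?T \<phi>)) * cmod (\<Prod>j = 1..k. D (\<phi> j)))
          \<le> norm (\<Prod>j = 1..k. complex_of_real (exp (- (w \<bullet> mult_cnj (\<phi> j)))) * D (\<phi> j))"
        unfolding prod[symmetric]
        by (intro AE_I2) (simp only: norm_mult norm_of_real real_norm_def abs_mult abs_norm_cancel abs_exp_cancel,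
            intro mult_right_mono exp_le sum_nonneg_orthant mult_cnj_nonneg norm_ge_zero)
      show "(\<lambda>\<phi>. exp (e * norm (?T \<phi>)) * cmod (\<Prod>j = 1..k. D (\<phi> j))) \<in> borel_measurable P"
        using borel_measurable_integrable[OF DP] T by simp
    qed
    show ?thesis
      unfolding F
      by (intro impI permanental_expectation[OF perm assms(4,5) DP T _ lap e(1) expi] sum_nonneg_orthant mult_cnj_nonneg)
  qed
  have F1: "(\<lambda>\<phi>. complex_of_real (1 / (pi ^ CARD('n) * det G) * f (mult_cnj \<phi>)) * exp (cpair \<phi> (cmat Q *v vcnj \<phi>)))
      = (\<lambda>\<phi>. complex_of_real (f (mult_cnj \<phi>)) * D \<phi>)"
    by (simp add: D_def fun_eq_iff)
  have Fk: "(\<lambda>\<phi>. complex_of_real (1 / (pi ^ (CARD('n) * k) * det G ^ k) * f (\<Sum>j = 1..k. mult_cnj (\<phi> j)))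
         * exp (\<Sum>j = 1..k. cpair (\<phi> j) (cmat Q *v vcnj (\<phi> j))))
      = (\<lambda>\<phi>. complex_of_real (f (\<Sum>j = 1..k. mult_cnj (\<phi> j))) * (\<Prod>j = 1..k. D (\<phi> j)))" for k :: nat
    by (simp add: D_def fun_eq_iff exp_sum prod.distrib prod_dividef power_mult power_mult_distrib)
  show ?thesis
    unfolding Let_def F1 Fk using one many by blast
qed

end
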